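(* Let $n \geq 3$. A map $Z : \mathcal{P}_o^n \to \mathcal{K}_o^n$ is an $\mathrm{SL}(n)$ contravariant $L_\infty$ Minkowski valuation if and only if there exist constants $c_1, c_2 \geq 0$ such that $$ZP = c_1 \hat{\Pi}_\infty^+ P +_\infty c_2 \hat{\Pi}_\infty^- P$$ for every $P \in \mathcal{P}_o^n$.
   Context: $\mathcal{K}_o^n$ denotes the set of convex bodies (compact convex sets) in $\mathbb{R}^n$ containing the origin $o$, and $\mathcal{P}_o^n$ the set of convex polytopes in $\mathbb{R}^n$ containing the origin. For a convex body $K$, $h_K(x)=\max\{x\cdot y: y\in K\}$ is its support function. For $K,L\in\mathcal{K}_o^n$, the $L_\infty$ Minkowski sum $K+_\infty L$ is the convex body with support function $h_{K+_\infty L}=\max\{h_K,h_L\}$ (i.e. the convex hull of $K\cup L$). A map $Z:\mathcal{P}_o^n\to\mathcal{K}_o^n$ is an $L_\infty$ Minkowski valuation if $Z(K\cup L)+_\infty Z(K\cap L)=ZK+_\infty ZL$ whenever $K,L,K\cup L,K\cap L\in\mathcal{P}_o^n$. $Z$ is $\mathrm{SL}(n)$ contravariant if $Z(\phi K)=\phi^{-t}ZK$ for all $K$ and all $\phi\in\mathrm{SL}(n)$. For $P\in\mathcal{P}_o^n$, let $\mathcal{N}(P)$ be the set of outer unit normals to the facets ($(n-1)$-dimensional faces) of $P$ and $\mathcal{N}_o(P)\subset\mathcal{N}(P)$ the set of outer unit normals to facets of $P$ that contain the origin. The asymmetric $L_\infty$ projection body is $\hat{\Pi}_\infty^+P=\mathrm{conv}\big(\{o\}\cup\{u/h_P(u):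 u\in\mathcal{N}(P)\setminus\mathcal{N}_o(P)\}\big)$, and $\hat{\Pi}_\infty^-P=-\hat{\Pi}_\infty^+P$. For $c\ge 0$, $cK=\{cx:x\in K\}$. *)

theory Defs
  imports "HOL-Analysis.Analysis"
begin

type_synonym 'n vec = "real ^ 'n"

definition Ko :: "('n::finite vec) set set" where
  "Ko = {K. compact K \<and> convex K \<and> 0 \<in> K}"

definition Po :: "('n::finite vec) set set" where
  "Po = {P. polytope P \<and> 0 \<in> P}"

definition supp :: "('n::finite vec) set \<Rightarrow> 'n vec \<Rightarrow> real" where
  "supp K x = Sup ((\<lambda>y. x \<bullet> y) ` K)"

definition linf_plus :: "('n::finite vec) set \<Rightarrow> 'n vec set \<Rightarrow> 'n vec set" (infixl "+\<^sub>\<infinity>" 65) where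
  "K +\<^sub>\<infinity> L = convex hull (K \<union> L)"

definition dil :: "real \<Rightarrow> ('n::finite vec) set \<Rightarrow> 'n vec set" where
  "dil c K = (\<lambda>x. c *\<^sub>R x) ` K"

definition is_facet :: "('n::finite vec) set \<Rightarrow> 'n vec set \<Rightarrow> bool" where
  "is_facet F P \<longleftrightarrow> F face_of P \<and> aff_dim F = int CARD('n) - 1"

definition outer_normal :: "('n::finite vec) set \<Rightarrow> 'n vec set \<Rightarrow> 'n vec \<Rightarrow> bool" where
  "outer_normal P F u \<longleftrightarrow> norm u = 1 \<and> (\<forall>x\<in>F. u \<bullet> x = supp P u)"

definition normals :: "('n::finite vec) set \<Rightarrow> 'n vec set" where
  "normals P = {u. \<exists>F. is_facet F P \<and> outer_normal P F u}"

definition normals_o :: "('n::finite vec) set \<Rightarrow> 'n vec set" where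
  "normals_o P = {u. \<exists>F. is_facet F P \<and> 0 \<in> F \<and> outer_normal P F u}"

definition Pi_plus :: "('n::finite vec) set \<Rightarrow> 'n vec set" where
  "Pi_plus P = convex hull (insert 0 ((\<lambda>u. (1 / supp P u) *\<^sub>R u) ` (normals P - normals_o P)))"

definition Pi_minus :: "('n::finite vec) set \<Rightarrow> 'n vec set" where
  "Pi_minus P = uminus ` Pi_plus P"

definition linf_valuation :: "(('n::finite vec) set \<Rightarrow> 'n vec set) \<Rightarrow> bool" where
  "linf_valuation Z \<longleftrightarrow> (\<forall>K L. K \<in> Po \<and> L \<in> Po \<and> K \<union> L \<in> Po \<and> K \<inter> L \<in> Po \<longrightarrow>
      Z (K \<union> L) +\<^sub>\<infinity> Z (K \<inter> L) = Z K +\<^sub>\<infinity> Z L)"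

definition SL_contravariant :: "(('n::finite vec) set \<Rightarrow> 'n vec set) \<Rightarrow> bool" where
  "SL_contravariant Z \<longleftrightarrow> (\<forall>K \<in> Po. \<forall>A :: real^'n^'n. det A = 1 \<longrightarrow>
      Z ((\<lambda>x. A *v x) ` K) = (\<lambda>x. matrix_inv (transpose A) *v x) ` Z K)"

end

theory Submission
  imports Defs
begin

text \<open>
  Write \<open>V P\<close> for the set of all \<open>u / h\<^sub>P(u)\<close>, where \<open>u\<close> runs over the normals of the facets not
  containing the origin. Membership in \<open>V P\<close> is a local condition at a relative interior point of a
  facet, which gives \<open>V (K \<union> L) \<union> V (K \<inter> L) = V K \<union> V L\<close> and hence the valuation property.

  Conversely, shears show that \<open>Z P\<close> lies on the normal line if \<open>P\<close> lies in a hyperplane through the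
  origin, and that it vanishes in codimension two. Bisecting a simplex of dimension \<open>n - 1\<close> with a
  vertex at the origin halves that segment, so \<open>Z\<close> vanishes on hyperplanes. Hence \<open>Z P\<close> is the
  convex hull of the values on the two halves of \<open>P\<close> cut along any hyperplane through the origin.
  Bisecting the standard simplex doubles the differences of the coordinates of points of the
  (pulled back) value but keeps the remaining coordinates bounded (this needs \<open>n \<ge> 3\<close>); so the value
  is a segment on the line through \<open>(1,\<dots>,1)\<close>, and it does not depend on the volume. A pyramid with
  apex at the origin is squeezed between two simplices with the same base hyperplane, and
  cutting along \<open>v\<^sub>1 \<bullet> x = v\<^sub>2 \<bullet> x\<close> reduces every polytope to pyramids. So \<open>Z\<close> is determined by
  its value on the standard simplex.
\<close>

section \<open>Linear algebra\<close>

text \<open>As a rewrite rule it would turn \<open>transpose A *v y\<close> into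
  \<open>y v* A\<close>, while contravariance is expressed through transposes below.\<close>

declare transpose_matrix_vector [simp del]

lemma inner_transpose_vector: "(transpose A *v y) \<bullet> x = y \<bullet> (A *v x)" for A :: "real^'n^'m"
  by (simp add: transpose_matrix_vector dot_lmul_matrix)

lemma inner_one_vec: "(1::real^'n) \<bullet> x = (\<Sum>i\<in>UNIV. x $ i)"
  by (simp add: inner_vec_def)

lemma transpose_mult_vector: "transpose (A ** B) *v y = transpose B *v (transpose A *v y)"
  for A B :: "real^'n^'n"
  by (simp only: matrix_transpose_mul matrix_vector_mul_assoc)

lemma det_nz_inverse:
  fixes A :: "real^'n^'n"
  assumes "det A \<noteq> 0"
  obtains C where "A ** C = mat 1" "C ** A = mat 1" "det C = 1 / det A"
proof -
  obtain C where C: "A ** C = mat 1" "C ** A = mat 1"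
    using assms invertible_det_nz unfolding invertible_def by blast
  have "det A * det C = 1" by (metis C(1) det_mul det_I)
  hence "det C = 1 / det A" using assms by (simp add: field_simps)
  thus ?thesis using that C by blast
qed

lemma matrix_vector_cancel:
  fixes A :: "real^'n^'n"
  assumes "det A \<noteq> 0" "A *v x = A *v y"
  shows "x = y"
proof -
  obtain C where "C ** A = mat 1" using det_nz_inverse[OF assms(1)] by blast
  thus ?thesis using assms(2) by (metis matrix_vector_mul_assoc matrix_vector_mul_lid)
qed

lemma matrix_vector_solve:
  fixes A :: "real^'n^'n"
  assumes "det A \<noteq> 0"
  obtains x where "A *v x = y"
proof -
  obtain C where "A ** C = mat 1" using det_nz_inverse[OF assms(1)] by blast
  hence "A *v (C *v y) = y" by (simp add: matrix_vector_mul_assoc)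
  thus ?thesis using that by blast
qed

lemma inj_matrix_vector: "det A \<noteq> 0 \<Longrightarrow> inj ((*v) A)" for A :: "real^'n^'n"
  by (meson injI matrix_vector_cancel)

lemma det_matrix_vector_inj: "(\<And>x. A *v x = 0 \<Longrightarrow> x = 0) \<Longrightarrow> det A \<noteq> 0" for A :: "real^'n^'n"
  using det_nz_iff_inj[of "(*v) A"] by (simp add: linear_injective_0)

text \<open>The matrix sending \<open>e\<^sub>j\<close> to \<open>c e\<^sub>i + d e\<^sub>j\<close> and fixing the other basis vectors.\<close>

definition elem_mat :: "'n \<Rightarrow> 'n \<Rightarrow> real \<Rightarrow> real \<Rightarrow> real^'n^'n" where
  "elem_mat i j c d = (\<chi> r s. if r = s then (if r = j then d else 1) else if r = i \<and> s = j then c else 0)"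

lemma elem_mat_vector:
  assumes "i \<noteq> j"
  shows "elem_mat i j c d *v x = (\<chi> r. if r = i then x $ i + c * x $ j else if r = j then d * x $ j else x $ r)"
proof -
  have "(elem_mat i j c d *v x) $ r = (if r = i then x $ i + c * x $ j else if r = j then d * x $ j else x $ r)" for r
  proof -
    have "(elem_mat i j c d *v x) $ r =
      (\<Sum>s\<in>UNIV. (if s = r then (if r = j then d else 1) * x $ s else 0) + (if s = j then (if r = i then c * x $ j else 0) else 0))"
      unfolding elem_mat_def matrix_vector_mult_def vec_lambda_beta
      by (rule sum.cong) (use assms in auto)
    also have "\<dots> = (if r = j then d else 1) * x $ r + (if r = i then c * x $ j else 0)"
      by (simp add: sum.distrib)
    finally show ?thesis using assms by auto
  qed
  thus ?thesis by (simp add: vec_eq_iff)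
qed

lemma transpose_elem_mat_vector:
  assumes "i \<noteq> j"
  shows "transpose (elem_mat i j c d) *v y = (\<chi> s. if s = j then c * y $ i + d * y $ j else y $ s)"
proof -
  have "(transpose (elem_mat i j c d) *v y) $ s = (if s = j then c * y $ i + d * y $ j else y $ s)" for s
  proof -
    have "(transpose (elem_mat i j c d) *v y) $ s =
      (\<Sum>r\<in>UNIV. (if r = s then (if r = j then d else 1) * y $ r else 0) + (if r = i then (if s = j then c * y $ i else 0) else 0))"
      unfolding elem_mat_def matrix_vector_mult_def transpose_def vec_lambda_beta
      by (rule sum.cong) (use assms in auto)
    also have "\<dots> = (if s = j then d else 1) * y $ s + (if s = j then c * y $ i else 0)"
      by (simp add: sum.distrib)
    finally show ?thesis by auto
  qed
  thus ?thesis by (simp add: vec_eq_iff)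
qed

text \<open>The matrix arises from the diagonal matrix \<open>D\<close> by adding
  \<open>c / d\<close> times row \<open>j\<close> to row \<open>i\<close>.\<close>

lemma det_elem_mat:
  assumes "i \<noteq> j" "d \<noteq> 0"
  shows "det (elem_mat i j c d) = d"
proof -
  define D :: "real^'a^'a" where "D = (\<chi> r s. if r = s then (if r = j then d else 1) else 0)"
  have "elem_mat i j c d = (\<chi> k. if k = i then row i D + (c / d) *s row j D else row k D)"
    using assms by (auto simp: elem_mat_def D_def row_def vec_eq_iff)
  hence "det (elem_mat i j c d) = det D" using det_row_operation[OF assms(1)] by metis
  also have "\<dots> = (\<Prod>r\<in>UNIV. D $ r $ r)" by (rule det_diagonal) (simp add: D_def)
  also have "\<dots> = (\<Prod>r\<in>UNIV. if r = j then d else 1)" by (simp add: D_def)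
  also have "\<dots> = d" by simp
  finally show ?thesis .
qed

lemma exists_other_index: "CARD('n::finite) \<ge> 2 \<Longrightarrow> \<exists>j::'n. j \<noteq> i"
proof (rule ccontr)
  assume n: "CARD('n) \<ge> 2" and "\<nexists>j. j \<noteq> i"
  hence "UNIV = {i}" by auto
  thus False using n by (metis card_1_singleton_iff One_nat_def Suc_1 not_less_eq_eq order_refl)
qed

lemma exists_third_index: 
  assumes "CARD('n::finite) \<ge> 3" shows "\<exists>k::'n. k \<noteq> i \<and> k \<noteq> j"
proof (rule ccontr)
  assume "\<not> ?thesis"
  hence "UNIV \<subseteq> {i,j}" by auto
  hence "CARD('n) \<le> card {i,j}" by (intro card_mono) auto
  also have "\<dots> \<le> 2" by (simp add: card_insert_if)
  finally show False using assms by simp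
qed

text \<open>Both pairs extend to bases, and a bijection of the bases respecting the pairs induces
  \<open>A\<close>. This serves to normalise the normal of a hyperplane and the functional bounding
  a pyramid to \<open>axis k 1\<close> and \<open>1\<close>.\<close>

lemma linear_automorphism_pairs:
  fixes a v a' v' :: "real^'n"
  assumes "a \<noteq> 0" "v \<notin> span {a}" "a' \<noteq> 0" "v' \<notin> span {a'}"
  obtains A :: "real^'n^'n" where "det A \<noteq> 0" "A *v a = a'" "A *v v = v'"
proof -
  have ind: "independent {v, a}" "independent {v', a'}" and ne: "v \<noteq> a" "v' \<noteq> a'"
    using assms by (auto simp: independent_insert span_base)
  obtain B where B: "{v,a} \<subseteq> B" "independent B" "UNIV \<subseteq> span B"
    using maximal_independent_subset_extend[OF _ ind(1), of UNIV] by auto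
  obtain B' where B': "{v',a'} \<subseteq> B'" "independent B'" "UNIV \<subseteq> span B'"
    using maximal_independent_subset_extend[OF _ ind(2), of UNIV] by auto
  have fin: "finite B" "finite B'" using B B' independent_imp_finite by auto
  have "card B = card B'"
    by (metis B(2,3) B'(2,3) dim_UNIV dim_eq_card_independent dim_span top.extremum_unique)
  hence "card (B - {v,a}) = card (B' - {v',a'})"
    using B(1) B'(1) fin ne by (simp add: card_Diff_subset)
  then obtain h where h: "bij_betw h (B - {v,a}) (B' - {v',a'})"
    using fin by (meson finite_Diff finite_same_card_bij)
  define f where "f x = (if x = a then a' else if x = v then v' else h x)" for x
  have "f ` B = B'" 
  proof -
    have "f ` B = f ` {v,a} \<union> f ` (B - {v,a})" using B(1) by blast
    also have "f ` (B - {v,a}) = h ` (B - {v,a})" by (rule image_cong) (auto simp: f_def)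
    also have "\<dots> = B' - {v',a'}" using h by (simp add: bij_betw_def)
    finally show ?thesis using B'(1) ne by (auto simp: f_def)
  qed
  moreover from this have "inj_on f B" using fin \<open>card B = card B'\<close> by (simp add: eq_card_imp_inj_on)
  ultimately obtain g where g: "linear g" "inj g" "\<forall>x\<in>B. g x = f x"
    using linear_independent_extend_inj[of B f] B B' by auto
  have "det (matrix g) \<noteq> 0" using g det_nz_iff_inj by blast
  moreover have "matrix g *v x = g x" for x using g(1) by simp
  ultimately show ?thesis using that[of "matrix g"] g(3) B(1) ne by (auto simp: f_def)
qed

lemma axis_one_independent:
  assumes "CARD('n) \<ge> 2" shows "(1::real^'n) \<notin> span {axis k 1}"
proof
  assume "(1::real^'n) \<in> span {axis k 1}"
  then obtain c where c: "(1::real^'n) = c *\<^sub>R axis k 1" by (auto simp: span_singleton)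
  obtain j where "j \<noteq> k" using exists_other_index[OF assms] by blast
  have "(1::real^'n) $ j = (c *\<^sub>R axis k 1 :: real^'n) $ j" using c by simp
  thus False using \<open>j \<noteq> k\<close> by (simp add: axis_def)
qed

lemma exists_not_in_span_singleton:
  fixes a :: "real^'n"
  assumes "CARD('n) \<ge> 2" shows "\<exists>v. v \<notin> span {a}"
proof (rule ccontr)
  assume "\<not> ?thesis"
  hence "span {a} = UNIV" by auto
  hence "dim {a} = CARD('n)" by (metis dim_UNIV dim_span DIM_cart DIM_real mult_1_right)
  moreover have "dim {a} \<le> 1" using dim_le_card'[of "{a}"] by simp
  ultimately show False using assms by simp
qed

section \<open>Polytopes containing the origin\<close>

lemma Po_linear_image: "P \<in> Po \<Longrightarrow> (*v) A ` P \<in> Po" for A :: "real^'n^'n"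
  unfolding Po_def using polytope_linear_image[of "(*v) A" P] by force

lemma Po_Int_polyhedron: "P \<in> Po \<Longrightarrow> polyhedron H \<Longrightarrow> 0 \<in> H \<Longrightarrow> P \<inter> H \<in> Po"
  unfolding Po_def by (simp add: polytope_Int_polyhedron)

lemma Po_Int_halfspaces:
  assumes "P \<in> Po"
  shows "P \<inter> {x. b \<bullet> x \<ge> 0} \<in> Po" "P \<inter> {x. b \<bullet> x \<le> 0} \<in> Po" "P \<inter> {x. b \<bullet> x = 0} \<in> Po"
  using assms by (auto intro!: Po_Int_polyhedron polyhedron_halfspace_ge polyhedron_halfspace_le polyhedron_hyperplane)

text \<open>Here \<open>1\<close> is the all-ones vector, so this is the standard simplex with a
  vertex at the origin.\<close>

definition simplex0 :: "(real^'n) set" where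
  "simplex0 = {x. (\<forall>i. 0 \<le> x $ i) \<and> 1 \<bullet> x \<le> 1}"

lemma simplex0_Po: "(simplex0 :: (real^'n) set) \<in> Po"
proof -
  have "(simplex0 :: (real^'n) set) = convex hull insert 0 (Basis :: (real^'n) set)"
  proof -
    have B: "(Basis :: (real^'n) set) = range (\<lambda>i. axis i 1)" by (auto simp: Basis_vec_def)
    have "inj (\<lambda>i::'n. axis i (1::real))" by (auto simp: inj_def axis_eq_axis)
    hence "sum ((\<bullet>) x) Basis = 1 \<bullet> x" for x :: "real^'n"
      unfolding B inner_one_vec by (simp add: sum.reindex inner_axis)
    thus ?thesis unfolding simplex0_def std_simplex by (auto simp: B inner_axis)
  qed
  moreover have "polytope (convex hull insert 0 (Basis :: (real^'n) set))"
    by (rule polytope_convex_hull) simp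
  moreover have "0 \<in> convex hull insert 0 (Basis :: (real^'n) set)" by (rule hull_inc) simp
  ultimately show ?thesis unfolding Po_def by simp
qed

text \<open>The matrix moves the vertex \<open>axis j 1\<close> to a point of the edge towards
  \<open>axis i 1\<close> and fixes the other vertices. The functional vanishes at the new point and
  at all vertices other than these two.\<close>

lemma elem_mat_simplex0:
  fixes i j :: "'n::finite"
  assumes ij: "i \<noteq> j" and l: "0 < l" "l < 1"
  shows "(*v) (elem_mat i j l (1 - l)) ` (simplex0 :: (real^'n) set) = simplex0 \<inter> {x. (axis i (1 - l) - axis j l) \<bullet> x \<ge> 0}"
    (is "?L = ?R")
proof
  let ?E = "elem_mat i j l (1 - l)"
  have T: "transpose ?E *v 1 = 1"
    using ij by (simp add: transpose_elem_mat_vector vec_eq_iff)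
  have one: "1 \<bullet> (?E *v x) = 1 \<bullet> x" for x
    by (metis T inner_transpose_vector)
  show "?L \<subseteq> ?R"
  proof clarify
    fix x :: "real^'n" assume x: "x \<in> simplex0"
    have "?E *v x \<in> simplex0"
      using x l unfolding simplex0_def one mem_Collect_eq by (auto simp: elem_mat_vector[OF ij])
    moreover have "(axis i (1 - l) - axis j l) \<bullet> (?E *v x) = (1 - l) * x $ i"
      using ij by (simp add: elem_mat_vector inner_diff_left inner_axis' algebra_simps)
    hence "(axis i (1 - l) - axis j l) \<bullet> (?E *v x) \<ge> 0" using x l by (simp add: simplex0_def)
    ultimately show "?E *v x \<in> ?R" by simp
  qed
  show "?R \<subseteq> ?L"
  proof
    fix x :: "real^'n" assume x: "x \<in> ?R"
    \<comment> \<open>Solution of \<open>?E *v y = x\<close>; its \<open>i\<close>-th coordinate is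
      nonnegative exactly on this side of the cut.\<close>
    define y :: "real^'n" where "y = (\<chi> r. if r = i then x $ i - l / (1 - l) * x $ j else if r = j then x $ j / (1 - l) else x $ r)"
    have E: "?E *v y = x" using ij l by (auto simp: elem_mat_vector y_def vec_eq_iff)
    have "(1 - l) * x $ i - l * x $ j \<ge> 0" using x by (simp add: inner_diff_left inner_axis')
    hence "x $ i - l / (1 - l) * x $ j \<ge> 0" using l by (simp add: field_simps)
    hence "y \<in> simplex0" using x l one[of y] unfolding E simplex0_def by (auto simp: y_def)
    thus "x \<in> ?L" using E by blast
  qed
qed

lemma elem_mat_simplex0':
  fixes i j :: "'n::finite"
  assumes ij: "i \<noteq> j" and l: "0 < l" "l < 1"
  shows "(*v) (elem_mat j i (1 - l) l) ` (simplex0 :: (real^'n) set) = simplex0 \<inter> {x. (axis i (1 - l) - axis j l) \<bullet> x \<le> 0}"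
proof -
  have "(*v) (elem_mat j i (1 - l) l) ` (simplex0 :: (real^'n) set) = simplex0 \<inter> {x. (axis j l - axis i (1 - l)) \<bullet> x \<ge> 0}"
    using elem_mat_simplex0[of j i "1 - l"] assms by simp
  thus ?thesis by (auto simp: inner_diff_left)
qed

text \<open>Pyramids with apex at the origin serve as induction base; cutting along \<open>v\<^sub>1 \<bullet> x = v\<^sub>2 \<bullet> x\<close>
  makes one of the two constraints \<open>v\<^sub>i \<bullet> x \<le> 1\<close> redundant on each side.\<close>

lemma Po_induct [consumes 1, case_names pyramid cut]:
  fixes P :: "(real^'n) set"
  assumes "P \<in> Po"
    and pyr: "\<And>P v W. P \<in> Po \<Longrightarrow> finite W \<Longrightarrow> P = {x. v \<bullet> x \<le> 1 \<and> (\<forall>w\<in>W. w \<bullet> x \<le> 0)} \<Longrightarrow> R P"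
    and cut: "\<And>P b. P \<in> Po \<Longrightarrow> R (P \<inter> {x. b \<bullet> x \<ge> 0}) \<Longrightarrow> R (P \<inter> {x. b \<bullet> x \<le> 0}) \<Longrightarrow> R P"
  shows "R P"
proof -
  have main: "R P" if "P \<in> Po" "finite A" "finite W" "card A = m"
      "P = {x. (\<forall>v\<in>A. v \<bullet> x \<le> 1) \<and> (\<forall>w\<in>W. w \<bullet> x \<le> 0)}" for P A W m
    using that
  proof (induction m arbitrary: P A W)
    case 0
    \<comment> \<open>With no inhomogeneous constraint left, the zero functional serves as
      \<open>v\<close>.\<close>
    hence "P = {x. 0 \<bullet> x \<le> 1 \<and> (\<forall>w\<in>W. w \<bullet> x \<le> 0)}" by auto
    thus ?case using pyr 0 by blast
  next
    case (Suc m)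
    show ?case
    proof (cases "m = 0")
      case True
      then obtain v where "A = {v}" using Suc.prems by (metis card_1_singletonE One_nat_def)
      hence "P = {x. v \<bullet> x \<le> 1 \<and> (\<forall>w\<in>W. w \<bullet> x \<le> 0)}" using Suc.prems by auto
      thus ?thesis using pyr Suc.prems by blast
    next
      case False
      then obtain v1 A' where A': "A = insert v1 A'" "v1 \<notin> A'" "card A' = m" 
        using Suc.prems by (metis card_Suc_eq)
      obtain v2 where v2: "v2 \<in> A'" using A' False by fastforce
      have fA: "finite A'" using A' Suc.prems by auto
      have half: "R (P \<inter> {x. (u1 - u2) \<bullet> x \<ge> 0})" if u: "u1 \<in> A" "u2 \<in> A" "u1 \<noteq> u2" for u1 u2
      proof (rule Suc.IH[of _ "A - {u2}" "insert (u2 - u1) W"])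
        show "P \<inter> {x. (u1 - u2) \<bullet> x \<ge> 0} \<in> Po" using Po_Int_halfspaces Suc.prems by blast
        show "card (A - {u2}) = m" using Suc.prems u by simp
        have "u2 \<bullet> x \<le> 1" if "u1 \<bullet> x \<le> 1" "(u1 - u2) \<bullet> x \<ge> 0" for x
          using that by (simp add: inner_diff_left)
        moreover have "((u1 - u2) \<bullet> x \<ge> 0) = ((u2 - u1) \<bullet> x \<le> 0)" for x by (simp add: inner_diff_left)
        ultimately show "P \<inter> {x. (u1 - u2) \<bullet> x \<ge> 0} =
          {x. (\<forall>v\<in>A - {u2}. v \<bullet> x \<le> 1) \<and> (\<forall>w\<in>insert (u2 - u1) W. w \<bullet> x \<le> 0)}"
          unfolding Suc.prems(5) using u by blast
      qed (use Suc.prems in auto)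
      have eq: "{x. (v2 - v1) \<bullet> x \<ge> 0} = {x. (v1 - v2) \<bullet> x \<le> 0}" by (auto simp: inner_diff_left)
      show ?thesis
        by (rule cut[of _ "v1 - v2"]) (use half[of v1 v2] half[of v2 v1] eq A' v2 Suc.prems in auto)
    qed
  qed
  have "polyhedron P" "0 \<in> P" using assms(1) by (auto simp: Po_def polytope_imp_polyhedron)
  then obtain F where F: "finite F" "P = \<Inter>F" "\<forall>h\<in>F. \<exists>a b. a \<noteq> 0 \<and> h = {x. a \<bullet> x \<le> b}"
    unfolding polyhedron_def by auto
  then obtain a b where ab: "\<And>h. h \<in> F \<Longrightarrow> h = {x. a h \<bullet> x \<le> b h}" by metis
  have b: "b h \<ge> 0" if "h \<in> F" for h
  proof -
    have "0 \<in> h" using \<open>0 \<in> P\<close> F that by auto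
    thus ?thesis using ab[OF that] by (metis inner_zero_right mem_Collect_eq)
  qed
  \<comment> \<open>The origin lies in \<open>P\<close>, so right-hand sides are nonnegative:
    positive ones are scaled to \<open>1\<close>, the others give homogeneous constraints.\<close>
  define A where "A = (\<lambda>h. a h /\<^sub>R b h) ` {h\<in>F. b h > 0}"
  define W where "W = a ` {h\<in>F. b h = 0}"
  have *: "x \<in> h \<longleftrightarrow> (if b h > 0 then (a h /\<^sub>R b h) \<bullet> x \<le> 1 else a h \<bullet> x \<le> 0)" if "h \<in> F" for h x
  proof -
    have "x \<in> h \<longleftrightarrow> a h \<bullet> x \<le> b h" using ab[OF that] by blast
    thus ?thesis using b[OF that] by (auto simp: divide_simps)
  qed
  have "x \<in> P \<longleftrightarrow> (\<forall>v\<in>A. v \<bullet> x \<le> 1) \<and> (\<forall>w\<in>W. w \<bullet> x \<le> 0)" for x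
  proof -
    have "x \<in> P \<longleftrightarrow> (\<forall>h\<in>F. x \<in> h)" using F by blast
    also have "\<dots> \<longleftrightarrow> (\<forall>h\<in>F. if b h > 0 then (a h /\<^sub>R b h) \<bullet> x \<le> 1 else a h \<bullet> x \<le> 0)" using * by blast
    also have "\<dots> \<longleftrightarrow> (\<forall>v\<in>A. v \<bullet> x \<le> 1) \<and> (\<forall>w\<in>W. w \<bullet> x \<le> 0)" 
      unfolding A_def W_def using b by force
    finally show ?thesis .
  qed
  hence "P = {x. (\<forall>v\<in>A. v \<bullet> x \<le> 1) \<and> (\<forall>w\<in>W. w \<bullet> x \<le> 0)}" by blast
  moreover have "finite A" "finite W" using F by (auto simp: A_def W_def)
  ultimately show ?thesis using main[OF assms(1)] by blast
qed

section \<open>Contravariant valuations on hyperplanes\<close>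

locale linf_contravariant_valuation =
  fixes Z :: "(real^'n) set \<Rightarrow> (real^'n) set"
  assumes card_ge_3: "CARD('n) \<ge> 3"
    and Z_Ko: "\<And>P. P \<in> Po \<Longrightarrow> Z P \<in> Ko"
    and Z_valuation: "linf_valuation Z"
    and Z_contravariant: "SL_contravariant Z"
begin

lemma Z_convex: "P \<in> Po \<Longrightarrow> convex (Z P)"
  and Z_bounded: "P \<in> Po \<Longrightarrow> bounded (Z P)"
  and Z_zero: "P \<in> Po \<Longrightarrow> 0 \<in> Z P"
  and Z_compact: "P \<in> Po \<Longrightarrow> compact (Z P)"
  using Z_Ko by (auto simp: Ko_def compact_imp_bounded)

lemma Z_SL:
  assumes "P \<in> Po" "det A = 1"
  shows "Z ((*v) A ` P) = {y. transpose A *v y \<in> Z P}"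
proof -
  define N where "N = matrix_inv (transpose A)"
  have "invertible (transpose A)" using assms by (simp add: invertible_det_nz)
  hence N: "transpose A ** N = mat 1 \<and> N ** transpose A = mat 1"
    unfolding N_def matrix_inv_def invertible_def by (rule someI_ex)
  have "Z ((*v) A ` P) = (*v) N ` Z P"
    using Z_contravariant assms unfolding SL_contravariant_def N_def by blast
  also have "\<dots> = {y. transpose A *v y \<in> Z P}"
  proof (intro equalityI subsetI)
    fix y assume "y \<in> (*v) N ` Z P"
    then obtain z where "y = N *v z" "z \<in> Z P" by blast
    thus "y \<in> {y. transpose A *v y \<in> Z P}" using N by (simp add: matrix_vector_mul_assoc)
  next
    fix y assume "y \<in> {y. transpose A *v y \<in> Z P}"
    moreover have "y = N *v (transpose A *v y)" using N by (simp add: matrix_vector_mul_assoc)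
    ultimately show "y \<in> (*v) N ` Z P" by blast
  qed
  finally show ?thesis .
qed

text \<open>Equal determinants give \<open>B = A ** C\<close> with \<open>det A = 1\<close>, so
  contravariance under \<open>A\<close> relates the two values.\<close>

lemma Z_equal_det:
  assumes "P \<in> Po" "det B = det C" "det C \<noteq> 0" "transpose B *v y = transpose C *v y'"
  shows "y \<in> Z ((*v) B ` P) \<longleftrightarrow> y' \<in> Z ((*v) C ` P)"
proof -
  obtain D where D: "C ** D = mat 1" "D ** C = mat 1" "det D = 1 / det C"
    using det_nz_inverse[OF assms(3)] .
  define A where "A = B ** D"
  have A: "det A = 1" "B = A ** C"
    using assms D by (auto simp: A_def det_mul matrix_mul_assoc[symmetric])
  have "(*v) B ` P = (*v) A ` (*v) C ` P"
    unfolding image_image A(2) matrix_vector_mul_assoc ..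
  hence "y \<in> Z ((*v) B ` P) \<longleftrightarrow> transpose A *v y \<in> Z ((*v) C ` P)"
    using Z_SL[OF Po_linear_image[OF assms(1)] A(1)] by simp
  moreover have "transpose C *v (transpose A *v y) = transpose C *v y'"
    using assms(4) by (simp add: A(2) transpose_mult_vector)
  hence "transpose A *v y = y'" using matrix_vector_cancel assms(3) by (metis det_transpose)
  ultimately show ?thesis by simp
qed

text \<open>Shears fixing the hyperplane pointwise would make \<open>Z P\<close> unbounded otherwise.\<close>

lemma Z_hyperplane_subset_line:
  assumes P: "P \<in> Po" and a: "a \<noteq> 0" "\<And>x. x \<in> P \<Longrightarrow> a \<bullet> x = 0" and y: "y \<in> Z P"
  shows "y \<in> span {a}"
proof -
  obtain k :: 'n where True by blast
  have c2: "CARD('n) \<ge> 2" using card_ge_3 by simp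
  obtain v where v: "v \<notin> span {a}" using exists_not_in_span_singleton[OF c2] by blast
  obtain A where A: "det A \<noteq> 0" "A *v a = axis k 1" "A *v v = 1"
    using linear_automorphism_pairs[OF a(1) v _ axis_one_independent[OF c2, of k]] by (auto simp: axis_eq_0_iff)
  define B where "B = transpose A"
  have B: "det B \<noteq> 0" "transpose B *v a = axis k 1" using A by (auto simp: B_def det_transpose transpose_transpose)
  define z where "z = transpose B *v y"
  have z0: "z $ i = 0" if "i \<noteq> k" for i
  proof (rule ccontr)
    assume zi: "z $ i \<noteq> 0"
    obtain D where D: "B ** D = mat 1" "D ** B = mat 1" using det_nz_inverse[OF B(1)] by metis
    define P' where "P' = (*v) D ` P"
    have P': "P' \<in> Po" unfolding P'_def by (rule Po_linear_image[OF P])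
    have BP: "(*v) B ` P' = P" unfolding P'_def image_image by (simp add: matrix_vector_mul_assoc D)
    have x0: "x $ k = 0" if "x \<in> P'" for x
    proof -
      have "a \<bullet> (B *v x) = 0" using that BP a(2) by blast
      hence "axis k 1 \<bullet> x = 0" by (metis B(2) inner_transpose_vector)
      thus ?thesis by (simp add: inner_axis')
    qed
    \<comment> \<open>The shear \<open>E\<close> fixes \<open>P'\<close> pointwise because
      \<open>x $ k = 0\<close> there, so \<open>B\<close> and \<open>B ** E\<close> represent the
      same polytope, while the transposed shear changes the \<open>k\<close>-th coordinate by a
      multiple of \<open>z $ i\<close>.\<close>
    have mem: "\<exists>y'\<in>Z P. (transpose B *v y') $ k = z $ k - c * z $ i" for c
    proof -
      define E :: "real^'n^'n" where "E = elem_mat i k c 1"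
      have dE: "det E = 1" unfolding E_def by (rule det_elem_mat) (use that in auto)
      have EP: "(*v) (B ** E) ` P' = P"
      proof -
        have "E *v x = x" if "x \<in> P'" for x
          using x0[OF that] \<open>i \<noteq> k\<close> by (simp add: E_def elem_mat_vector vec_eq_iff)
        hence "(*v) (B ** E) ` P' = (*v) B ` P'"
          by (intro image_cong) (auto simp flip: matrix_vector_mul_assoc)
        thus ?thesis using BP by simp
      qed
      define z' where "z' = transpose (elem_mat i k (-c) 1) *v z"
      obtain y' where y': "transpose B *v y' = z'"
        using matrix_vector_solve[of "transpose B" z'] B(1) by (auto simp: det_transpose)
      have "transpose E *v z' = z" using \<open>i \<noteq> k\<close>
        by (simp add: E_def z'_def transpose_elem_mat_vector vec_eq_iff)
      hence "transpose (B ** E) *v y' = transpose B *v y" 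
        by (simp add: transpose_mult_vector y' z_def)
      hence "y' \<in> Z P"
        using Z_equal_det[OF P', of "B ** E" B y' y] y EP BP dE B(1) by (simp add: det_mul)
      moreover have "z' $ k = z $ k - c * z $ i" using \<open>i \<noteq> k\<close>
        by (simp add: z'_def transpose_elem_mat_vector)
      ultimately show ?thesis using y' by auto
    qed
    have "bounded ((*v) (transpose B) ` Z P)" 
      using bounded_linear_image[OF Z_bounded[OF P]] matrix_vector_mul_bounded_linear by blast
    then obtain K where K: "\<And>y'. y' \<in> Z P \<Longrightarrow> norm (transpose B *v y') \<le> K" 
      unfolding bounded_iff by auto
    \<comment> \<open>The shear parameter is chosen to make this coordinate equal to
      \<open>K + 1\<close>.\<close>
    obtain y' where y': "y' \<in> Z P" "(transpose B *v y') $ k = z $ k - ((z $ k - K - 1) / z $ i) * z $ i"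
      using mem by blast
    have "(transpose B *v y') $ k = K + 1" using y'(2) zi by simp
    thus False using component_le_norm_cart[of "transpose B *v y'" k] K[OF y'(1)] by simp
  qed
  have "transpose B *v y = transpose B *v (z $ k *\<^sub>R a)"
    unfolding matrix_vector_mult_scaleR B(2) z_def[symmetric] using z0 by (auto simp: vec_eq_iff axis_def)
  hence "y = z $ k *\<^sub>R a" using matrix_vector_cancel B(1) by (metis det_transpose)
  thus ?thesis by (simp add: span_base span_scale)
qed

text \<open>The value lies on the two distinct lines spanned by \<open>a\<close> and
  \<open>b\<close>.\<close>

lemma Z_codim_two:
  assumes P: "P \<in> Po" and a: "a \<noteq> 0" "\<And>x. x \<in> P \<Longrightarrow> a \<bullet> x = 0"
    and b: "b \<notin> span {a}" "\<And>x. x \<in> P \<Longrightarrow> b \<bullet> x = 0"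
  shows "Z P = {0}"
proof -
  have "y = 0" if y: "y \<in> Z P" for y
  proof (rule ccontr)
    assume "y \<noteq> 0"
    have "b \<noteq> 0" using b(1) span_zero by auto
    obtain s where s: "y = s *\<^sub>R a" using Z_hyperplane_subset_line[OF P a y] by (auto simp: span_singleton)
    obtain t where "y = t *\<^sub>R b"
      using Z_hyperplane_subset_line[OF P \<open>b \<noteq> 0\<close> b(2) y] by (auto simp: span_singleton)
    note st = s this
    have "t \<noteq> 0" using st \<open>y \<noteq> 0\<close> by auto
    hence "b = inverse t *\<^sub>R (t *\<^sub>R b)" by simp
    also have "\<dots> = (inverse t * s) *\<^sub>R a" using st by (metis scaleR_scaleR)
    finally have "b = (inverse t * s) *\<^sub>R a" .
    thus False using b(1) by (auto simp: span_singleton)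
  qed
  thus ?thesis using Z_zero[OF P] by auto
qed

text \<open>Valuation identity for the two halves, which meet in the slice; the slice contributes
  only the origin, a point of \<open>Z P\<close> anyway.\<close>

lemma Z_cut:
  assumes P: "P \<in> Po" and Z0: "Z (P \<inter> {x. b \<bullet> x = 0}) = {0}"
  shows "Z P = convex hull (Z (P \<inter> {x. b \<bullet> x \<ge> 0}) \<union> Z (P \<inter> {x. b \<bullet> x \<le> 0}))"
proof -
  let ?K = "P \<inter> {x. b \<bullet> x \<ge> 0}" and ?L = "P \<inter> {x. b \<bullet> x \<le> 0}"
  have un: "?K \<union> ?L = P" by auto
  have int: "?K \<inter> ?L = P \<inter> {x. b \<bullet> x = 0}" by auto
  have "?K \<in> Po \<and> ?L \<in> Po \<and> ?K \<union> ?L \<in> Po \<and> ?K \<inter> ?L \<in> Po"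
    unfolding un int using Po_Int_halfspaces[OF P, of b] P by blast
  hence "Z (?K \<union> ?L) +\<^sub>\<infinity> Z (?K \<inter> ?L) = Z ?K +\<^sub>\<infinity> Z ?L"
    using Z_valuation unfolding linf_valuation_def by blast
  moreover have "Z P \<union> {0} = Z P" using Z_zero[OF P] by auto
  ultimately show ?thesis unfolding un int Z0 linf_plus_def
    using Z_convex[OF P] by (simp add: convex_hull_eq[THEN iffD2])
qed

text \<open>Either \<open>b\<close> is a multiple of \<open>a\<close> and both halves are
  \<open>P\<close>, or the slice satisfies two independent equations.\<close>

lemma Z_cut_in_hyperplane:
  assumes P: "P \<in> Po" and a: "a \<noteq> 0" "\<And>x. x \<in> P \<Longrightarrow> a \<bullet> x = 0"
  shows "Z P = convex hull (Z (P \<inter> {x. b \<bullet> x \<ge> 0}) \<union> Z (P \<inter> {x. b \<bullet> x \<le> 0}))"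
proof (cases "b \<in> span {a}")
  case True
  then obtain c where c: "b = c *\<^sub>R a" by (auto simp: span_singleton)
  hence "P \<inter> {x. b \<bullet> x \<ge> 0} = P" "P \<inter> {x. b \<bullet> x \<le> 0} = P" using a by auto
  thus ?thesis using Z_convex[OF P] by (simp add: convex_hull_eq[THEN iffD2])
next
  case False
  have "Z (P \<inter> {x. b \<bullet> x = 0}) = {0}"
    by (rule Z_codim_two[OF _ a(1) _ False]) (use a P Po_Int_halfspaces in auto)
  thus ?thesis by (rule Z_cut[OF P])
qed

text \<open>Pulled back to \<open>S\<close>, the value of \<open>Z\<close> on a linear image of \<open>S\<close> depends only on the determinant.\<close>

definition pullback :: "(real^'n) set \<Rightarrow> real \<Rightarrow> (real^'n) set" where
  "pullback S t = {transpose B *v y |B y. det B = t \<and> y \<in> Z ((*v) B ` S)}"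

text \<open>By \<open>Z_equal_det\<close>, all matrices of one determinant contribute the same
  points to \<open>pullback\<close>.\<close>

lemma Z_image_pullback:
  assumes "S \<in> Po" "det B \<noteq> 0"
  shows "y \<in> Z ((*v) B ` S) \<longleftrightarrow> transpose B *v y \<in> pullback S (det B)"
proof
  assume "transpose B *v y \<in> pullback S (det B)"
  then obtain C y' where "transpose B *v y = transpose C *v y'" "det C = det B" "y' \<in> Z ((*v) C ` S)"
    unfolding pullback_def by blast
  thus "y \<in> Z ((*v) B ` S)" using Z_equal_det[OF assms(1), of B C y y'] assms(2) by simp
qed (auto simp: pullback_def)

lemma exists_det: "\<exists>B::real^'n^'n. det B = t" if "t \<noteq> 0"
proof -
  obtain i j :: 'n where "j \<noteq> i" using exists_third_index[OF card_ge_3] by metis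
  hence "det (elem_mat i j 0 t) = t" using that by (simp add: det_elem_mat)
  thus ?thesis by blast
qed

lemma pullback_eq_image:
  assumes "S \<in> Po" "det B \<noteq> 0"
  shows "pullback S (det B) = (*v) (transpose B) ` Z ((*v) B ` S)"
proof (intro equalityI subsetI)
  fix z assume z: "z \<in> pullback S (det B)"
  obtain y where "transpose B *v y = z" using matrix_vector_solve[of "transpose B" z] assms by (auto simp: det_transpose)
  thus "z \<in> (*v) (transpose B) ` Z ((*v) B ` S)" using z Z_image_pullback[OF assms] by blast
qed (use Z_image_pullback[OF assms] in auto)

lemma pullback_bounded: 
  assumes "S \<in> Po" "t \<noteq> 0" shows "bounded (pullback S t)"
proof -
  obtain B :: "real^'n^'n" where B: "det B = t" using exists_det assms by blast
  have "bounded ((*v) (transpose B) ` Z ((*v) B ` S))"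
    by (intro bounded_linear_image[OF Z_bounded] Po_linear_image assms matrix_vector_mul_bounded_linear)
  thus ?thesis using pullback_eq_image[of S B] assms B by simp
qed

text \<open>The functional \<open>c\<close> is \<open>b\<close> transported by \<open>B\<close>, and
  the halves become the images of \<open>S\<close> under \<open>B ** E\<close> and
  \<open>B ** F\<close>. The cut identity is a hypothesis because it is available first inside
  hyperplanes and only later in general.\<close>

lemma pullback_cut:
  assumes S: "S \<in> Po" and t: "t \<noteq> 0" and E: "det E \<noteq> 0" "det F \<noteq> 0"
    and split: "(*v) E ` S = S \<inter> {x. b \<bullet> x \<ge> 0}" "(*v) F ` S = S \<inter> {x. b \<bullet> x \<le> 0}"
    and cut: "\<And>B c. det B \<noteq> 0 \<Longrightarrow> transpose B *v c = b \<Longrightarrow> Z ((*v) B ` S) =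
       convex hull (Z ((*v) B ` S \<inter> {x. c \<bullet> x \<ge> 0}) \<union> Z ((*v) B ` S \<inter> {x. c \<bullet> x \<le> 0}))"
  shows "pullback S t = convex hull ({z. transpose E *v z \<in> pullback S (t * det E)} \<union> {z. transpose F *v z \<in> pullback S (t * det F)})"
proof -
  obtain B :: "real^'n^'n" where B: "det B = t" using exists_det t by blast
  obtain c where c: "transpose B *v c = b" using matrix_vector_solve[of "transpose B" b] B t by (auto simp: det_transpose)
  have dB: "det (transpose B) \<noteq> 0" using B t by (simp add: det_transpose)
  have cx: "c \<bullet> (B *v x) = b \<bullet> x" for x by (metis c inner_transpose_vector)
  have "(*v) (B ** E) ` S = (*v) B ` ((*v) E ` S)" "(*v) (B ** F) ` S = (*v) B ` ((*v) F ` S)"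
    by (simp_all add: image_image matrix_vector_mul_assoc)
  hence im: "(*v) B ` S \<inter> {x. c \<bullet> x \<ge> 0} = (*v) (B ** E) ` S" "(*v) B ` S \<inter> {x. c \<bullet> x \<le> 0} = (*v) (B ** F) ` S"
    unfolding split by (auto simp: cx)
  have tr: "(*v) (transpose B) ` Z ((*v) (B ** G) ` S) = {z. transpose G *v z \<in> pullback S (t * det G)}" if G: "det G \<noteq> 0" for G
  proof -
    have *: "y \<in> Z ((*v) (B ** G) ` S) \<longleftrightarrow> transpose G *v (transpose B *v y) \<in> pullback S (t * det G)" for y
      using Z_image_pullback[OF S, of "B ** G"] G B t by (simp add: det_mul transpose_mult_vector)
    show ?thesis
    proof (intro equalityI subsetI)
      fix z assume z: "z \<in> {z. transpose G *v z \<in> pullback S (t * det G)}"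
      obtain y where "transpose B *v y = z" using matrix_vector_solve[OF dB] by blast
      thus "z \<in> (*v) (transpose B) ` Z ((*v) (B ** G) ` S)" using z * by blast
    qed (use * in auto)
  qed
  have "pullback S t = (*v) (transpose B) ` Z ((*v) B ` S)" using pullback_eq_image S B t by metis
  also have "\<dots> = convex hull ((*v) (transpose B) ` Z ((*v) (B ** E) ` S) \<union> (*v) (transpose B) ` Z ((*v) (B ** F) ` S))"
    by (subst cut[OF _ c]) (use B t in \<open>simp_all add: im convex_hull_linear_image image_Un\<close>)
  finally show ?thesis unfolding tr[OF E(1)] tr[OF E(2)] .
qed
end

section \<open>Simplices and pyramids\<close>

definition face0 :: "'n \<Rightarrow> (real^'n) set" where
  "face0 k = simplex0 \<inter> {x. axis k 1 \<bullet> x = 0}"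

lemma face0_Po: "face0 k \<in> Po"
  unfolding face0_def by (rule Po_Int_halfspaces(3)[OF simplex0_Po])

text \<open>Neither matrix touches coordinate \<open>k\<close>, so the cut of the full simplex
  restricts to the facet.\<close>

lemma elem_mat_face0:
  fixes i j k :: "'n::finite"
  assumes ij: "i \<noteq> j" and k: "k \<noteq> i" "k \<noteq> j" and l: "0 < l" "l < 1"
  shows "(*v) (elem_mat i j l (1 - l)) ` face0 k = face0 k \<inter> {x. (axis i (1 - l) - axis j l) \<bullet> x \<ge> 0}"
    and "(*v) (elem_mat j i (1 - l) l) ` face0 k = face0 k \<inter> {x. (axis i (1 - l) - axis j l) \<bullet> x \<le> 0}"
proof -
  have *: "(*v) (elem_mat i j c d) ` face0 k = (*v) (elem_mat i j c d) ` simplex0 \<inter> {x. axis k 1 \<bullet> x = 0}" 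
    if "i \<noteq> j" "k \<noteq> i" "k \<noteq> j" for i j :: 'n and c d
  proof -
    have "axis k 1 \<bullet> (elem_mat i j c d *v x) = axis k 1 \<bullet> x" for x
      using that by (simp add: elem_mat_vector inner_axis')
    thus ?thesis unfolding face0_def by auto
  qed
  show "(*v) (elem_mat i j l (1 - l)) ` face0 k = face0 k \<inter> {x. (axis i (1 - l) - axis j l) \<bullet> x \<ge> 0}"
    unfolding *[OF ij k] elem_mat_simplex0[OF ij l] by (auto simp: face0_def)
  show "(*v) (elem_mat j i (1 - l) l) ` face0 k = face0 k \<inter> {x. (axis i (1 - l) - axis j l) \<bullet> x \<le> 0}"
    unfolding *[OF ij[symmetric] k(2,1)] elem_mat_simplex0'[OF ij l] by (auto simp: face0_def)
qed

section \<open>Pyramids with apex at the origin\<close>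

lemma Po_bounded:
  assumes "P \<in> Po" obtains K where "\<And>x. x \<in> P \<Longrightarrow> norm x \<le> K"
  using assms polytope_imp_bounded[of P] unfolding Po_def bounded_iff by blast

text \<open>Otherwise all constraints survive scaling \<open>x\<close> up, and \<open>P\<close>
  would contain an entire ray.\<close>

lemma pyramid_ray:
  fixes v :: "real^'n"
  assumes "P \<in> Po" "P = {x. v \<bullet> x \<le> 1 \<and> (\<forall>w\<in>W. w \<bullet> x \<le> 0)}" "x \<in> P" "x \<noteq> 0"
  shows "v \<bullet> x > 0"
proof (rule ccontr)
  assume "\<not> v \<bullet> x > 0"
  hence v: "v \<bullet> x \<le> 0" by simp
  obtain K where K: "\<And>x. x \<in> P \<Longrightarrow> norm x \<le> K"
    using Po_bounded[OF assms(1)] by blast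
  have K0: "K \<ge> 0" using K[OF assms(3)] norm_ge_zero order_trans by blast
  define s where "s = (K + 1) / norm x"
  have s: "s \<ge> 0" using K0 by (simp add: s_def)
  have "s *\<^sub>R x \<in> P"
  proof -
    have "s * (v \<bullet> x) \<le> 0" using s v by (simp add: mult_nonneg_nonpos)
    moreover have "s * (w \<bullet> x) \<le> 0" if "w \<in> W" for w
      using s assms(2,3) that by (auto simp: mult_nonneg_nonpos)
    ultimately show ?thesis unfolding assms(2) by auto
  qed
  hence "norm (s *\<^sub>R x) \<le> K" by (rule K)
  moreover have "norm (s *\<^sub>R x) = K + 1" using assms(4) K0 by (simp add: s_def)
  ultimately show False by simp
qed

lemma pyramid_pullback:
  fixes v :: "real^'n"
  assumes "P \<in> Po" "finite W" "P = {x. v \<bullet> x \<le> 1 \<and> (\<forall>w\<in>W. w \<bullet> x \<le> 0)}"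
    and B: "det B \<noteq> 0" "transpose B *v v = 1"
  obtains Q W' where "Q \<in> Po" "finite W'" "Q = {x. 1 \<bullet> x \<le> 1 \<and> (\<forall>w\<in>W'. w \<bullet> x \<le> 0)}" "P = (*v) B ` Q"
proof -
  obtain D where D: "B ** D = mat 1" "D ** B = mat 1" using det_nz_inverse[OF B(1)] by metis
  have BD: "B *v (D *v x) = x" "D *v (B *v x) = x" for x by (simp_all add: matrix_vector_mul_assoc D)
  define Q where "Q = (*v) D ` P"
  have mem: "x \<in> Q \<longleftrightarrow> B *v x \<in> P" for x unfolding Q_def by (metis BD image_iff)
  have "Q = {x. 1 \<bullet> x \<le> 1 \<and> (\<forall>w\<in>(*v) (transpose B) ` W. w \<bullet> x \<le> 0)}"
    by (auto simp: mem assms(3) inner_transpose_vector simp flip: B(2))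
  moreover have "Q \<in> Po" unfolding Q_def by (rule Po_linear_image[OF assms(1)])
  moreover have "P = (*v) B ` Q" unfolding Q_def image_image BD by simp
  ultimately show ?thesis using that assms(2) by blast
qed

text \<open>The homothety with ratio \<open>e\<close> and centre \<open>p\<close> in the hyperplane \<open>1 \<bullet> x = 1\<close>, extended linearly.\<close>

definition stretch :: "real \<Rightarrow> real^'n \<Rightarrow> real^'n^'n" where
  "stretch e p = matrix (\<lambda>z. e *\<^sub>R z + ((1 - e) * (1 \<bullet> z)) *\<^sub>R p)"

lemma stretch_vector: "stretch e p *v z = e *\<^sub>R z + ((1 - e) * (1 \<bullet> z)) *\<^sub>R p"
proof -
  have "linear (\<lambda>z. e *\<^sub>R z + ((1 - e) * (1 \<bullet> z)) *\<^sub>R p)"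
    by (rule linearI) (simp_all add: algebra_simps inner_add_right)
  thus ?thesis unfolding stretch_def by simp
qed

context
  fixes e :: real and p :: "real^'n"
  assumes e: "e \<noteq> 0" and p: "1 \<bullet> p = 1"
begin

lemma inner_one_stretch: "1 \<bullet> (stretch e p *v z) = 1 \<bullet> z"
  using p by (simp add: stretch_vector inner_add_right algebra_simps)

lemma transpose_stretch_one: "transpose (stretch e p) *v 1 = 1"
  by (rule vector_eq_rdot[THEN iffD1]) (simp add: inner_transpose_vector inner_one_stretch)

lemma det_stretch: "det (stretch e p) \<noteq> 0"
proof (rule det_matrix_vector_inj)
  fix x assume x: "stretch e p *v x = 0"
  hence "1 \<bullet> x = 0" by (metis inner_one_stretch inner_zero_right)
  thus "x = 0" using x e by (simp add: stretch_vector)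
qed

end

text \<open>Enlarging the base of the simplex about a point \<open>p\<close> with coordinates at
  least \<open>1 / N\<close> eventually covers the bounded base of \<open>P\<close>. The alternative
  for coordinates vanishing on \<open>P\<close> admits pyramids inside a coordinate
  hyperplane.\<close>

lemma pyramid_outer_simplex:
  fixes P :: "(real^'n) set"
  assumes P: "P \<in> Po" "P = {x. 1 \<bullet> x \<le> 1 \<and> (\<forall>w\<in>W. w \<bullet> x \<le> 0)}"
    and p: "1 \<bullet> p = 1" "N > 0" "\<And>i. p $ i \<ge> 1 / N \<or> (p $ i = 0 \<and> (\<forall>x\<in>P. x $ i = 0))"
  obtains e where "e > 0" "P \<subseteq> (*v) (stretch e p) ` simplex0"
proof -
  obtain K where K: "\<And>x. x \<in> P \<Longrightarrow> norm x \<le> K"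
    using Po_bounded[OF P(1)] by blast
  have "K \<ge> 0" using K[of 0] P(1) by (simp add: Po_def)
  \<comment> \<open>Makes \<open>(e - 1) * p $ i\<close> at least \<open>K\<close> wherever
    \<open>p $ i\<close> is at least \<open>1 / N\<close>, which outweighs the coordinates of points
    in the base of \<open>P\<close>.\<close>
  define e where "e = 1 + K * N"
  have e: "e \<ge> 1" using \<open>K \<ge> 0\<close> p(2) by (simp add: e_def)
  have "x \<in> (*v) (stretch e p) ` simplex0" if x: "x \<in> P" for x
  proof -
    define s where "s = 1 \<bullet> x"
    \<comment> \<open>The preimage of \<open>x\<close> under the stretch, which preserves the
      coordinate sum \<open>s\<close>.\<close>
    define z where "z = (1 / e) *\<^sub>R (x + ((e - 1) * s) *\<^sub>R p)"
    have "1 \<bullet> z = (s + (e - 1) * s) / e" using p(1) by (simp add: z_def inner_add_right s_def)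
    hence z1: "1 \<bullet> z = s" using e by (simp add: field_simps)
    have "e *\<^sub>R z = x + ((e - 1) * s) *\<^sub>R p" using e by (simp add: z_def)
    hence "stretch e p *v z = x" unfolding stretch_vector z1 by (simp add: algebra_simps)
    moreover have "z \<in> simplex0"
    proof -
      have "1 \<bullet> z \<le> 1" unfolding z1 s_def using x P(2) by auto
      moreover have "z $ i \<ge> 0" for i
      proof (cases "x = 0 \<or> (p $ i = 0 \<and> (\<forall>x\<in>P. x $ i = 0))")
        case True
        thus ?thesis using x by (auto simp: z_def s_def)
      next
        case False
        hence pi: "p $ i \<ge> 1 / N" using p(3) by blast
        have s: "s > 0" unfolding s_def using pyramid_ray[OF P x] False by blast
        \<comment> \<open>Radial projection to the base stays in the pyramid, so the bound
          \<open>K\<close> there becomes \<open>K * s\<close> at \<open>x\<close>.\<close>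
        have "(1 / s) *\<^sub>R x \<in> P"
        proof -
          have "(1 / s) * (w \<bullet> x) \<le> 0" if "w \<in> W" for w
            using s x P(2) that by (auto intro!: divide_nonpos_pos)
          thus ?thesis unfolding P(2) using s by (auto simp flip: s_def)
        qed
        hence "\<bar>((1 / s) *\<^sub>R x) $ i\<bar> \<le> K" using K component_le_norm_cart order_trans by blast
        hence "\<bar>x $ i\<bar> \<le> K * s" using s by (simp add: field_simps abs_mult)
        moreover have "K * s \<le> (e - 1) * s * p $ i"
        proof -
          have "K * s = K * N * s * (1 / N)" using p(2) by simp
          also have "\<dots> \<le> K * N * s * p $ i" using pi s p(2) \<open>K \<ge> 0\<close> by (intro mult_left_mono) auto
          finally show ?thesis by (simp add: e_def)
        qed
        ultimately show ?thesis using e by (simp add: z_def)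
      qed
      ultimately show ?thesis by (simp add: simplex0_def)
    qed
    ultimately show ?thesis by (metis image_eqI)
  qed
  thus ?thesis using that[of e] e by auto
qed

text \<open>An interior point is projected radially to a point \<open>p\<close> of the base
  hyperplane; a small homothetic copy of the base of the standard simplex about \<open>p\<close>
  satisfies the homogeneous constraints.\<close>

lemma pyramid_inner_simplex:
  fixes P :: "(real^'n) set"
  assumes P: "P \<in> Po" "P = {x. 1 \<bullet> x \<le> 1 \<and> (\<forall>w\<in>W. w \<bullet> x \<le> 0)}"
    and ne: "interior P \<noteq> {}"
  obtains e p where "e > 0" "1 \<bullet> p = 1" "(*v) (stretch e p) ` simplex0 \<subseteq> P"
proof -
  obtain u where u: "u \<in> interior P" "u \<noteq> 0"
  proof -
    have "interior P \<noteq> {0}" using not_open_singleton open_interior by metis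
    thus ?thesis using ne that by blast
  qed
  then obtain r where r: "r > 0" "ball u r \<subseteq> P" using mem_interior by blast
  define h where "h = 1 \<bullet> u"
  have h: "h > 0" unfolding h_def using pyramid_ray[OF P _ u(2)] u(1) interior_subset by blast
  define p where "p = (1 / h) *\<^sub>R u"
  have p: "1 \<bullet> p = 1" using h by (simp add: p_def flip: h_def)
  have up: "u = h *\<^sub>R p" using h by (simp add: p_def)
  \<comment> \<open>Strictly exceeds the distance from \<open>u\<close> to each
    \<open>h *\<^sub>R axis i 1\<close>, so the ratio \<open>r / C\<close> keeps the point
    \<open>?q\<close> below in the ball around \<open>u\<close>.\<close>
  define C where "C = norm u + h + 1"
  have C: "C > 0" using h by (simp add: C_def add_nonneg_pos)
  define e where "e = r / C"
  have e: "e > 0" using r C by (simp add: e_def)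
  have w: "w \<bullet> (stretch e p *v z) \<le> 0" if w: "w \<in> W" and z: "z \<in> simplex0" for w z
  proof -
    have ax: "w \<bullet> ((1 - e) *\<^sub>R p + e *\<^sub>R axis i 1) \<le> 0" for i
    proof -
      let ?q = "(1 - e) *\<^sub>R u + (e * h) *\<^sub>R axis i 1"
      have "norm (?q - u) = e * norm (h *\<^sub>R axis i 1 - u)"
      proof -
        have "?q - u = e *\<^sub>R (h *\<^sub>R axis i 1 - u)" by (simp add: algebra_simps)
        thus ?thesis using e by simp
      qed
      also have "\<dots> \<le> e * (h + norm u)" using e h norm_triangle_ineq4[of "h *\<^sub>R axis i 1" u] 
        by (intro mult_left_mono) auto
      also have "\<dots> < e * C" using e by (simp add: C_def)
      also have "\<dots> = r" using C by (simp add: e_def)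
      finally have "?q \<in> P" using r by (auto simp: dist_norm norm_minus_commute)
      hence "w \<bullet> ?q \<le> 0" using P(2) w by auto
      moreover have "?q = h *\<^sub>R ((1 - e) *\<^sub>R p + e *\<^sub>R axis i 1)" 
        by (simp add: up algebra_simps)
      ultimately show ?thesis using h by (simp add: mult_le_0_iff)
    qed
    have "stretch e p *v z = (\<Sum>i\<in>UNIV. z $ i *\<^sub>R ((1 - e) *\<^sub>R p + e *\<^sub>R axis i 1))"
    proof -
      have "z = (\<Sum>i\<in>UNIV. z $ i *\<^sub>R axis i 1)"
        by (simp add: vec_eq_iff axis_def if_distrib cong: if_cong)
      hence "e *\<^sub>R z = (\<Sum>i\<in>UNIV. z $ i *\<^sub>R (e *\<^sub>R axis i 1))"
        by (metis (no_types, lifting) scaleR_left_commute scaleR_sum_right sum.cong)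
      thus ?thesis unfolding stretch_vector inner_one_vec
        by (simp add: scaleR_add_right sum.distrib sum_distrib_left scaleR_sum_left mult.commute)
    qed
    hence "w \<bullet> (stretch e p *v z) = (\<Sum>i\<in>UNIV. z $ i * (w \<bullet> ((1 - e) *\<^sub>R p + e *\<^sub>R axis i 1)))"
      by (simp add: inner_sum_right)
    also have "\<dots> \<le> 0" using ax z by (intro sum_nonpos mult_nonneg_nonpos) (auto simp: simplex0_def)
    finally show ?thesis .
  qed
  have "(*v) (stretch e p) ` simplex0 \<subseteq> P"
    using w e p unfolding P(2) by (auto simp: inner_one_stretch simplex0_def)
  thus ?thesis using that e p by blast
qed

section \<open>Vanishing on hyperplanes\<close>

context linf_contravariant_valuation begin

text \<open>Both halves of the bisected face are images of it under matrices of determinant \<open>1/2\<close> on the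
  hyperplane, which scale the segment \<open>Z (face0 k)\<close> by \<open>1/2\<close>.\<close>

lemma Z_face0:
  assumes "det B \<noteq> 0"
  shows "Z ((*v) B ` face0 k) = {0}"
proof -
  have perp: "\<exists>a. a \<noteq> 0 \<and> transpose C *v a = axis k 1 \<and> (\<forall>x\<in>(*v) C ` face0 k. a \<bullet> x = 0)" if "det C \<noteq> 0" for C
  proof -
    have "det (transpose C) \<noteq> 0" using that by (simp add: det_transpose)
    then obtain a where a: "transpose C *v a = axis k 1" using matrix_vector_solve by blast
    moreover have "a \<noteq> 0" using a by (auto simp: axis_eq_0_iff)
    moreover have "a \<bullet> (C *v x) = axis k 1 \<bullet> x" for x by (metis a inner_transpose_vector)
    hence "\<forall>x\<in>(*v) C ` face0 k. a \<bullet> x = 0" by (auto simp: face0_def)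
    ultimately show ?thesis by blast
  qed
  have line: "z \<in> span {axis k 1}" if z: "z \<in> pullback (face0 k) t" and t: "t \<noteq> 0" for z t
  proof -
    obtain C y where C: "z = transpose C *v y" "det C = t" "y \<in> Z ((*v) C ` face0 k)"
      using z unfolding pullback_def by blast
    obtain a where a: "a \<noteq> 0" "transpose C *v a = axis k 1" "\<forall>x\<in>(*v) C ` face0 k. a \<bullet> x = 0"
      using perp C(2) t by blast
    have "y \<in> span {a}" using Z_hyperplane_subset_line[OF Po_linear_image[OF face0_Po] a(1) _ C(3)] a(3) by blast
    then obtain c where "y = c *\<^sub>R a" by (auto simp: span_singleton)
    hence "z = c *\<^sub>R axis k 1" by (simp add: C(1) a(2) matrix_vector_mult_scaleR)
    thus ?thesis by (simp add: span_base span_scale)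
  qed
  obtain i where ik: "i \<noteq> k" using exists_third_index[OF card_ge_3] by metis
  \<comment> \<open>\<open>D\<close> scales \<open>axis k 1\<close> and fixes the face pointwise:
    the polytope stays the same, while the determinant and the pulled back value are both multiplied
    by \<open>c\<close>.\<close>
  have scale: "c *\<^sub>R z \<in> pullback (face0 k) (t * c)"
    if z: "z \<in> pullback (face0 k) t" and t: "t \<noteq> 0" and c: "c \<noteq> 0" for z t c
  proof -
    obtain C y where C: "z = transpose C *v y" "det C = t" "y \<in> Z ((*v) C ` face0 k)"
      using z unfolding pullback_def by blast
    define D where "D = elem_mat i k 0 c"
    have "D *v x = x" if "x \<in> face0 k" for x
      using that ik by (simp add: D_def face0_def elem_mat_vector vec_eq_iff inner_axis')
    hence "(*v) (C ** D) ` face0 k = (*v) C ` face0 k"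
      by (intro image_cong) (auto simp flip: matrix_vector_mul_assoc)
    moreover have "det (C ** D) = t * c" using ik c C(2) by (simp add: det_mul D_def det_elem_mat)
    moreover have "transpose (C ** D) *v y = c *\<^sub>R z"
    proof -
      obtain s where s: "z = s *\<^sub>R axis k 1" using line[OF z t] by (auto simp: span_singleton)
      have "transpose (C ** D) *v y = transpose D *v z" unfolding transpose_mult_vector C(1) ..
      also have "\<dots> = c *\<^sub>R z" unfolding s D_def transpose_elem_mat_vector[OF ik]
        by (auto simp: vec_eq_iff axis_def)
      finally show ?thesis .
    qed
    ultimately show ?thesis using C(3) unfolding pullback_def
      by (intro CollectI exI[of _ "C ** D"] exI[of _ y]) simp
  qed
  obtain j where j: "j \<noteq> i" "j \<noteq> k" using exists_third_index[OF card_ge_3] by metis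
  define t where "t = det B"
  have t: "t \<noteq> 0" using assms by (simp add: t_def)
  let ?S = "face0 k"
  define E where "E = elem_mat i j (1/2) (1 - 1/2)"
  define F where "F = elem_mat j i (1 - 1/2) (1/2)"
  have det: "det E = 1/2" "det F = 1/2" using j by (simp_all add: E_def F_def det_elem_mat)
  have "pullback ?S t = convex hull ({z. transpose E *v z \<in> pullback ?S (t * det E)} \<union> {z. transpose F *v z \<in> pullback ?S (t * det F)})"
  proof (rule pullback_cut[OF face0_Po t])
    show "(*v) E ` ?S = ?S \<inter> {x. (axis i (1 - 1/2) - axis j (1/2)) \<bullet> x \<ge> 0}"
      unfolding E_def by (rule elem_mat_face0) (use j ik in auto)
    show "(*v) F ` ?S = ?S \<inter> {x. (axis i (1 - 1/2) - axis j (1/2)) \<bullet> x \<le> 0}"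
      unfolding F_def by (rule elem_mat_face0) (use j ik in auto)
    fix C :: "real^'n^'n" and c assume C: "det C \<noteq> 0"
    obtain a where a: "a \<noteq> 0" "\<forall>x\<in>(*v) C ` face0 k. a \<bullet> x = 0" using perp[OF C] by blast
    show "Z ((*v) C ` ?S) = convex hull (Z ((*v) C ` ?S \<inter> {x. c \<bullet> x \<ge> 0}) \<union> Z ((*v) C ` ?S \<inter> {x. c \<bullet> x \<le> 0}))"
      by (rule Z_cut_in_hyperplane[OF Po_linear_image[OF face0_Po] a(1)]) (use a(2) in auto)
  qed (use det in auto)
  hence cut: "pullback ?S t = convex hull ({z. transpose E *v z \<in> pullback ?S (t / 2)} \<union> {z. transpose F *v z \<in> pullback ?S (t / 2)})"
    by (simp add: det)
  \<comment> \<open>Twice a point of the pullback for \<open>t / 2\<close> lies in the one for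
    \<open>t\<close>, which is bounded by \<open>K\<close>, and \<open>transpose G\<close> fixes the
    axis carrying these points.\<close>
  have half: "norm z \<le> K / 2" if K: "\<And>z. z \<in> pullback ?S t \<Longrightarrow> norm z \<le> K"
    and G: "det G \<noteq> 0" "transpose G *v axis k 1 = axis k 1" and z: "transpose G *v z \<in> pullback ?S (t / 2)" for K z G
  proof -
    obtain s where s: "transpose G *v z = s *\<^sub>R axis k 1" using line[OF z] t by (auto simp: span_singleton)
    also have "\<dots> = transpose G *v (s *\<^sub>R axis k 1)" by (simp add: matrix_vector_mult_scaleR G(2))
    finally have "z = s *\<^sub>R axis k 1" using matrix_vector_cancel G(1) by (metis det_transpose)
    moreover have "2 *\<^sub>R (transpose G *v z) \<in> pullback ?S t" using scale[OF z, of 2] t by simp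
    ultimately show ?thesis using K[of "2 *\<^sub>R (transpose G *v z)"] s by simp
  qed
  have EF: "transpose E *v axis k 1 = axis k 1" "transpose F *v axis k 1 = axis k 1"
    unfolding E_def F_def using j ik by (auto simp: transpose_elem_mat_vector vec_eq_iff axis_def)
  have step: "norm z \<le> K / 2" if K: "\<And>z. z \<in> pullback ?S t \<Longrightarrow> norm z \<le> K" and z: "z \<in> pullback ?S t" for K z
  proof -
    have "pullback ?S t \<subseteq> cball 0 (K / 2)"
      by (subst cut, rule hull_minimal) (use half[OF K _ EF(1)] half[OF K _ EF(2)] det in \<open>auto simp: convex_cball\<close>)
    thus ?thesis using z by auto
  qed
  obtain K where K: "\<And>z. z \<in> pullback ?S t \<Longrightarrow> norm z \<le> K"
    using pullback_bounded[OF face0_Po t] unfolding bounded_iff by blast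
  have pow: "norm z \<le> K * (1/2)^m" if "z \<in> pullback ?S t" for z m
    using that
  proof (induction m arbitrary: z)
    case (Suc m)
    show ?case using step[OF Suc.IH Suc.prems] by simp
  qed (use K in simp)
  have zero: "z = 0" if z: "z \<in> pullback ?S t" for z
  proof (rule ccontr)
    assume "z \<noteq> 0"
    hence K0: "K > 0" using K[OF z] by (meson less_le_trans zero_less_norm_iff)
    obtain m where "(1/2::real)^m < norm z / K"
      using real_arch_pow_inv[of "norm z / K" "1/2"] K0 \<open>z \<noteq> 0\<close> by auto
    hence "K * (1/2)^m < norm z" using K0 by (simp add: field_simps)
    thus False using pow[OF z, of m] by simp
  qed
  have "y = 0" if "y \<in> Z ((*v) B ` ?S)" for y
  proof -
    have "transpose B *v y = transpose B *v 0" using zero Z_image_pullback[OF face0_Po assms] that by (simp add: t_def)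
    thus ?thesis using matrix_vector_cancel assms by (metis det_transpose)
  qed
  thus ?thesis using Z_zero[OF Po_linear_image[OF face0_Po]] by blast
qed

text \<open>The cut identity puts the value of a half inside the value of the whole, so homogeneous
  constraints can be imposed one at a time. Asking for the identity only on subsets of
  \<open>P\<close> lets the lemma serve inside a hyperplane as well.\<close>

lemma Z_mono_cut:
  assumes P: "P \<in> Po" and W: "finite W"
    and cut: "\<And>Q b. Q \<in> Po \<Longrightarrow> Q \<subseteq> P \<Longrightarrow> Z Q = convex hull (Z (Q \<inter> {x. b \<bullet> x \<ge> 0}) \<union> Z (Q \<inter> {x. b \<bullet> x \<le> 0}))"
  shows "P \<inter> {x. \<forall>w\<in>W. w \<bullet> x \<le> 0} \<in> Po \<and> Z (P \<inter> {x. \<forall>w\<in>W. w \<bullet> x \<le> 0}) \<subseteq> Z P"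
  using W
proof induction
  case (insert w W)
  let ?Q = "P \<inter> {x. \<forall>w\<in>W. w \<bullet> x \<le> 0}"
  have "P \<inter> {x. \<forall>w\<in>insert w W. w \<bullet> x \<le> 0} = ?Q \<inter> {x. w \<bullet> x \<le> 0}" by auto
  moreover have "Z (?Q \<inter> {x. w \<bullet> x \<le> 0}) \<subseteq> Z ?Q"
  proof -
    have "?Q \<subseteq> P" by blast
    hence "Z ?Q = convex hull (Z (?Q \<inter> {x. w \<bullet> x \<ge> 0}) \<union> Z (?Q \<inter> {x. w \<bullet> x \<le> 0}))"
      using cut insert.IH by blast
    thus ?thesis using hull_subset[of "Z (?Q \<inter> {x. w \<bullet> x \<ge> 0}) \<union> Z (?Q \<inter> {x. w \<bullet> x \<le> 0})" convex] by blast
  qed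
  ultimately show ?case using insert.IH Po_Int_halfspaces(2)[of ?Q w] by auto
qed (use P in auto)

text \<open>Cuts reduce the claim to pyramids. A pyramid other than the origin is cut out of an
  image of some \<open>face0 k\<close> by homogeneous constraints and inherits the value
  \<open>{0}\<close> by monotonicity.\<close>

lemma Z_hyperplane:
  assumes "P \<in> Po" "a \<noteq> 0" "P \<subseteq> {x. a \<bullet> x = 0}"
  shows "Z P = {0}"
  using assms(1,3)
proof (induction rule: Po_induct)
  case (cut P b)
  hence "Z (P \<inter> {x. b \<bullet> x \<ge> 0}) = {0}" "Z (P \<inter> {x. b \<bullet> x \<le> 0}) = {0}" by blast+
  moreover have "Z P = convex hull (Z (P \<inter> {x. b \<bullet> x \<ge> 0}) \<union> Z (P \<inter> {x. b \<bullet> x \<le> 0}))"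
    by (rule Z_cut_in_hyperplane[OF cut(1) assms(2)]) (use cut.prems in auto)
  ultimately show ?case by simp
next
  case (pyramid P v W)
  have c2: "CARD('n) \<ge> 2" using card_ge_3 by simp
  show ?case
  proof (cases "P = {0}")
    case True
    obtain b where b: "b \<notin> span {a}" using exists_not_in_span_singleton[OF c2] by blast
    show ?thesis by (rule Z_codim_two[OF pyramid(1) assms(2) _ b]) (use True in auto)
  next
    case False
    then obtain x1 where x1: "x1 \<in> P" "x1 \<noteq> 0" using pyramid(1) by (auto simp: Po_def)
    have "v \<bullet> x1 > 0" using pyramid_ray[OF pyramid(1,3) x1] .
    hence v: "v \<notin> span {a}" using pyramid.prems x1 by (auto simp: span_singleton)
    obtain k :: 'n where True by blast
    obtain A where A: "det A \<noteq> 0" "A *v a = axis k 1" "A *v v = 1"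
      using linear_automorphism_pairs[OF assms(2) v _ axis_one_independent[OF c2, of k]] by (auto simp: axis_eq_0_iff)
    define B where "B = transpose A"
    have B: "det B \<noteq> 0" "transpose B *v a = axis k 1" "transpose B *v v = 1"
      using A by (auto simp: B_def det_transpose transpose_transpose)
    obtain Q W' where Q: "Q \<in> Po" "finite W'" "Q = {x. 1 \<bullet> x \<le> 1 \<and> (\<forall>w\<in>W'. w \<bullet> x \<le> 0)}" "P = (*v) B ` Q"
      using pyramid_pullback[OF pyramid(1-3) B(1,3)] by blast
    have Qk: "x $ k = 0" if "x \<in> Q" for x
    proof -
      have "a \<bullet> (B *v x) = 0" using that Q(4) pyramid.prems by blast
      hence "axis k 1 \<bullet> x = 0" by (metis B(2) inner_transpose_vector)
      thus ?thesis by (simp add: inner_axis')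
    qed
    define N where "N = real CARD('n) - 1"
    have N: "N > 0" using card_ge_3 by (simp add: N_def)
    \<comment> \<open>Barycentre of the base of \<open>face0 k\<close>: its \<open>k\<close>-th
      coordinate is zero, so stretching about \<open>p\<close> preserves the hyperplane.\<close>
    define p :: "real^'n" where "p = (\<chi> i. if i = k then 0 else 1 / N)"
    have p: "1 \<bullet> p = 1"
    proof -
      have "1 \<bullet> p = (\<Sum>i\<in>UNIV - {k}. 1 / N)" unfolding inner_one_vec p_def
        by (rule sum.mono_neutral_cong_right) auto
      also have "\<dots> = 1" using N card_ge_3 by (simp add: N_def card_Diff_subset of_nat_diff)
      finally show ?thesis .
    qed
    obtain e where e: "e > 0" "Q \<subseteq> (*v) (stretch e p) ` simplex0"
      by (rule pyramid_outer_simplex[OF Q(1,3) p N]) (use Qk in \<open>auto simp: p_def\<close>)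
    define G where "G = B ** stretch e p"
    have dG: "det G \<noteq> 0" using B det_stretch[OF _ p] e by (simp add: G_def det_mul)
    let ?S = "(*v) G ` face0 k"
    have S: "?S \<in> Po" by (rule Po_linear_image[OF face0_Po])
    have Sa: "a \<bullet> x = 0" if "x \<in> ?S" for x
    proof -
      obtain z where z: "x = G *v z" "z \<in> face0 k" using \<open>x \<in> ?S\<close> by blast
      have "a \<bullet> x = axis k 1 \<bullet> (stretch e p *v z)"
        unfolding z(1) G_def matrix_vector_mul_assoc[symmetric] inner_transpose_vector[symmetric] B(2) by simp
      thus ?thesis using z(2) by (simp add: stretch_vector face0_def inner_axis' p_def)
    qed
    have "Q \<subseteq> (*v) (stretch e p) ` face0 k"
    proof
      fix x assume x: "x \<in> Q"
      then obtain z where z: "x = stretch e p *v z" "z \<in> simplex0" using e by blast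
      have "x $ k = e * z $ k" using z by (simp add: stretch_vector p_def)
      hence "z \<in> face0 k" using Qk[OF x] e(1) z by (simp add: face0_def inner_axis')
      thus "x \<in> (*v) (stretch e p) ` face0 k" using z by blast
    qed
    hence "P \<subseteq> (*v) B ` (*v) (stretch e p) ` face0 k" using Q(4) by blast
    also have "\<dots> = ?S" by (simp add: image_image G_def matrix_vector_mul_assoc)
    finally have PS: "P \<subseteq> ?S" .
    have "v \<bullet> x \<le> 1" if "x \<in> ?S" for x
    proof -
      obtain z where z: "x = G *v z" "z \<in> face0 k" using \<open>x \<in> ?S\<close> by blast
      have "v \<bullet> x = 1 \<bullet> (stretch e p *v z)"
        unfolding z(1) G_def matrix_vector_mul_assoc[symmetric] inner_transpose_vector[symmetric] B(3) by simp
      also have "\<dots> = 1 \<bullet> z" by (rule inner_one_stretch) (use e p in auto)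
      finally show ?thesis using z(2) by (simp add: face0_def simplex0_def)
    qed
    \<comment> \<open>The bound by \<open>v\<close> already holds on \<open>?S\<close>, so only the
      homogeneous constraints remain.\<close>
    hence PW: "P = ?S \<inter> {x. \<forall>w\<in>W. w \<bullet> x \<le> 0}" using PS pyramid(3) by blast
    have "Z P \<subseteq> Z ?S" unfolding PW
    proof (rule Z_mono_cut[OF S pyramid(2), THEN conjunct2])
      fix Q b assume "Q \<in> Po" "Q \<subseteq> ?S"
      thus "Z Q = convex hull (Z (Q \<inter> {x. b \<bullet> x \<ge> 0}) \<union> Z (Q \<inter> {x. b \<bullet> x \<le> 0}))"
        using Sa by (intro Z_cut_in_hyperplane[OF _ assms(2)]) auto
    qed
    also have "\<dots> = {0}" by (rule Z_face0[OF dG])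
    finally show ?thesis using Z_zero[OF pyramid(1)] by blast
  qed
qed

text \<open>The slice lies in a hyperplane through the origin, so its value is \<open>{0}\<close>
  and the cut identity becomes unconditional.\<close>

lemma Z_cut_hull:
  assumes P: "P \<in> Po"
  shows "Z P = convex hull (Z (P \<inter> {x. b \<bullet> x \<ge> 0}) \<union> Z (P \<inter> {x. b \<bullet> x \<le> 0}))"
proof (cases "b = 0")
  case True
  thus ?thesis using Z_convex[OF P] by (simp add: convex_hull_eq[THEN iffD2])
next
  case False
  show ?thesis by (rule Z_cut[OF P], rule Z_hyperplane[OF _ False]) (use P Po_Int_halfspaces in auto)
qed

end

section \<open>Values on simplices and pyramids\<close>

context linf_contravariant_valuation begin

lemma pullback_simplex0_cut:
  fixes i j :: 'n
  assumes "i \<noteq> j" "0 < l" "l < 1" "t \<noteq> 0"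
  shows "pullback simplex0 t = convex hull ({z. transpose (elem_mat i j l (1 - l)) *v z \<in> pullback simplex0 (t * (1 - l))}
     \<union> {z. transpose (elem_mat j i (1 - l) l) *v z \<in> pullback simplex0 (t * l)})"
proof -
  have det: "det (elem_mat i j l (1 - l)) = 1 - l" "det (elem_mat j i (1 - l) l) = l"
    using assms by (simp_all add: det_elem_mat)
  show ?thesis
    using pullback_cut[OF simplex0_Po assms(4) _ _ elem_mat_simplex0[OF assms(1-3)] elem_mat_simplex0'[OF assms(1-3)]
       Z_cut_hull[OF Po_linear_image[OF simplex0_Po]]] assms
    by (simp add: det)
qed

lemma pullback_simplex0_expand:
  fixes i j :: 'n
  assumes "i \<noteq> j" "0 < l" "l < 1" "t \<noteq> 0"
    "transpose (elem_mat i j l (1 - l)) *v z \<in> pullback simplex0 (t * (1 - l))"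
  shows "z \<in> pullback simplex0 t"
  unfolding pullback_simplex0_cut[OF assms(1-4)] using assms(5) by (intro hull_inc) simp

text \<open>In dimension at least three, \<open>i\<close> and \<open>j\<close> can both avoid
  \<open>k\<close>. The transposed bisection matrices then preserve coordinate \<open>k\<close>, so
  the bound passes to twice the determinant.\<close>

lemma pullback_simplex0_coord_bound:
  assumes "t \<noteq> 0" and K: "\<And>z k. z \<in> pullback simplex0 t \<Longrightarrow> \<bar>z $ k\<bar> \<le> K"
  shows "z \<in> pullback simplex0 (2 ^ m * t) \<Longrightarrow> \<bar>z $ k\<bar> \<le> K"
proof (induction m arbitrary: z k)
  case (Suc m)
  obtain i where i: "i \<noteq> k" using exists_third_index[OF card_ge_3] by metis
  obtain j where j: "j \<noteq> i" "j \<noteq> k" using exists_third_index[OF card_ge_3] by metis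
  define X where "X = {z :: real^'n. \<bar>z $ k\<bar> \<le> K}"
  have "convex X"
  proof -
    have "X = {z. axis k 1 \<bullet> z \<le> K} \<inter> {z. axis k 1 \<bullet> z \<ge> - K}" by (auto simp: X_def inner_axis')
    thus ?thesis by (simp add: convex_Int convex_halfspace_le convex_halfspace_ge)
  qed
  let ?s = "2 ^ m * t"
  have s: "2 ^ Suc m * t \<noteq> 0" "2 ^ Suc m * t * (1 - 1/2) = ?s" "2 ^ Suc m * t * (1/2) = ?s" using assms(1) by auto
  have kk: "(transpose (elem_mat i j c d) *v z) $ k = z $ k" "(transpose (elem_mat j i c d) *v z) $ k = z $ k" for c d z
    using i j by (simp_all add: transpose_elem_mat_vector)
  have "\<bar>z $ k\<bar> \<le> K" if "transpose (elem_mat i j c d) *v z \<in> pullback simplex0 ?s \<or>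
      transpose (elem_mat j i c d) *v z \<in> pullback simplex0 ?s" for z c d
    using that Suc.IH[of "transpose (elem_mat i j c d) *v z" k] Suc.IH[of "transpose (elem_mat j i c d) *v z" k]
    unfolding kk by blast
  hence "{z. transpose (elem_mat i j (1/2) (1 - 1/2)) *v z \<in> pullback simplex0 ?s} \<union>
        {z. transpose (elem_mat j i (1 - 1/2) (1/2)) *v z \<in> pullback simplex0 ?s} \<subseteq> X"
    unfolding X_def by blast
  hence "pullback simplex0 (2 ^ Suc m * t) \<subseteq> X"
    using pullback_simplex0_cut[OF j(1)[symmetric] _ _ s(1), of "1/2"] \<open>convex X\<close> unfolding s
    by (simp add: hull_minimal)
  thus ?case using Suc.prems by (auto simp: X_def)
qed (use K in auto)

text \<open>Halving the simplex doubles coordinate differences, while the coordinates themselves stay bounded.\<close>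

lemma pullback_simplex0_coords_eq:
  assumes t: "t \<noteq> 0" and z: "z \<in> pullback simplex0 t"
  shows "z $ i = z $ j"
proof (rule ccontr)
  assume ne: "z $ i \<noteq> z $ j"
  hence ij: "i \<noteq> j" by auto
  obtain K where "\<And>z. z \<in> pullback simplex0 t \<Longrightarrow> norm z \<le> K"
    using pullback_bounded[OF simplex0_Po t] unfolding bounded_iff by blast
  hence K: "\<bar>z $ k\<bar> \<le> K" if "z \<in> pullback simplex0 t" for z k
    using that component_le_norm_cart[of z k] order_trans by blast
  have double: "\<exists>z'. z' \<in> pullback simplex0 (2 ^ m * t) \<and> z' $ j - z' $ i = 2 ^ m * (z $ j - z $ i)" for m
  proof (induction m)
    case (Suc m)
    then obtain z' where z': "z' \<in> pullback simplex0 (2 ^ m * t)" "z' $ j - z' $ i = 2 ^ m * (z $ j - z $ i)" by blast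
    \<comment> \<open>The point that the transposed bisection matrix takes to
      \<open>z'\<close>.\<close>
    define y where "y = (\<chi> s. if s = j then 2 * z' $ j - z' $ i else z' $ s)"
    have Ey: "transpose (elem_mat i j (1/2) (1 - 1/2)) *v y = z'"
      unfolding transpose_elem_mat_vector[OF ij] by (simp add: y_def vec_eq_iff ij diff_divide_distrib)
    have "y \<in> pullback simplex0 (2 ^ Suc m * t)"
      by (rule pullback_simplex0_expand[OF ij, of "1/2"]) (use Ey z'(1) t in auto)
    moreover have "y $ j - y $ i = 2 * (z' $ j - z' $ i)" using ij by (simp add: y_def)
    hence "y $ j - y $ i = 2 ^ Suc m * (z $ j - z $ i)" unfolding z'(2) by simp
    ultimately show ?case by blast
  qed (use z in auto)
  have bd: "2 ^ m * \<bar>z $ j - z $ i\<bar> \<le> 2 * K" for m :: nat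
  proof -
    obtain z' where z': "z' \<in> pullback simplex0 (2 ^ m * t)" "z' $ j - z' $ i = 2 ^ m * (z $ j - z $ i)" using double by blast
    have "2 ^ m * \<bar>z $ j - z $ i\<bar> = \<bar>z' $ j - z' $ i\<bar>" unfolding z'(2) by (simp add: abs_mult)
    also have "\<dots> \<le> 2 * K" using pullback_simplex0_coord_bound[OF t K z'(1), of i]
      pullback_simplex0_coord_bound[OF t K z'(1), of j] by linarith
    finally show ?thesis .
  qed
  obtain m where "2 * K / \<bar>z $ j - z $ i\<bar> < 2 ^ m" using real_arch_pow[of 2 "2 * K / \<bar>z $ j - z $ i\<bar>"] by auto
  moreover have "\<bar>z $ j - z $ i\<bar> > 0" using ne by simp
  ultimately show False using bd[of m] by (simp add: pos_divide_less_eq)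
qed

lemma pullback_simplex0_line:
  assumes "t \<noteq> 0" "z \<in> pullback simplex0 t" obtains s where "z = s *\<^sub>R 1"
proof -
  obtain k :: 'n where True by blast
  have "z $ i = (z $ k *\<^sub>R 1) $ i" for i using pullback_simplex0_coords_eq[OF assms, of i k] by simp
  hence "z = z $ k *\<^sub>R 1" unfolding vec_eq_iff by blast
  thus ?thesis using that by blast
qed

section \<open>Independence of the pulled back value from the determinant\<close>

lemma transpose_elem_mat_const: 
  assumes "i \<noteq> (j::'n)" shows "transpose (elem_mat i j l (1 - l)) *v (s *\<^sub>R 1) = s *\<^sub>R 1"
  unfolding transpose_elem_mat_vector[OF assms] by (simp add: vec_eq_iff algebra_simps)

text \<open>The values are multiples of \<open>1\<close>, which the transposed cutting matrix for
  \<open>l = 1 - r\<close> fixes, so the piece of determinant \<open>t * r\<close> enters the hull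
  unchanged.\<close>

lemma pullback_simplex0_mono:
  assumes "t \<noteq> 0" "0 < r" "r < 1"
  shows "pullback simplex0 (t * r) \<subseteq> pullback simplex0 t"
proof
  fix z assume z: "z \<in> pullback simplex0 (t * r)"
  obtain i j :: 'n where ij: "i \<noteq> j" using exists_third_index[OF card_ge_3] by metis
  obtain s where s: "z = s *\<^sub>R 1" using pullback_simplex0_line[OF _ z] assms by auto
  show "z \<in> pullback simplex0 t"
    by (rule pullback_simplex0_expand[OF ij, of "1 - r"])
       (use assms z transpose_elem_mat_const[OF ij, of "1 - r" s] s in auto)
qed

text \<open>Both halves of a bisection have determinant \<open>t / 2\<close> and contribute the same
  convex set, as multiples of \<open>1\<close> are fixed.\<close>

lemma pullback_simplex0_half:
  assumes "t \<noteq> 0"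
  shows "pullback simplex0 t = pullback simplex0 (t / 2)"
proof
  show "pullback simplex0 (t / 2) \<subseteq> pullback simplex0 t"
    using pullback_simplex0_mono[OF assms, of "1/2"] by simp
  obtain i j :: 'n where ij: "i \<noteq> j" using exists_third_index[OF card_ge_3] by metis
  have sub: "z \<in> pullback simplex0 (t / 2)" 
    if z: "transpose (elem_mat i j (1/2) (1 - 1/2)) *v z \<in> pullback simplex0 (t / 2)" and ij: "i \<noteq> j" for z and i j :: 'n
  proof -
    obtain s where s: "transpose (elem_mat i j (1/2) (1 - 1/2)) *v z = s *\<^sub>R 1"
      using pullback_simplex0_line[OF _ z] assms by auto
    have "det (transpose (elem_mat i j (1/2) (1 - 1/2)) :: real^'n^'n) \<noteq> 0" using ij by (simp add: det_transpose det_elem_mat)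
    hence "z = s *\<^sub>R 1"
      by (rule matrix_vector_cancel) (simp only: s transpose_elem_mat_const[OF ij])
    thus ?thesis using z s by simp
  qed
  have "convex (pullback simplex0 (t / 2))"
  proof -
    obtain B :: "real^'n^'n" where B: "det B = t / 2" using exists_det[of "t / 2"] assms by auto
    have "convex ((*v) (transpose B) ` Z ((*v) B ` simplex0))"
      by (intro convex_linear_image Z_convex Po_linear_image simplex0_Po) simp
    thus ?thesis using pullback_eq_image[OF simplex0_Po, of B] assms B by simp
  qed
  moreover have "{z. transpose (elem_mat i j (1/2) (1 - 1/2)) *v z \<in> pullback simplex0 (t / 2)}
       \<union> {z. transpose (elem_mat j i (1/2) (1 - 1/2)) *v z \<in> pullback simplex0 (t / 2)} \<subseteq> pullback simplex0 (t / 2)"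
    using sub[OF _ ij] sub[OF _ ij[symmetric]] by blast
  ultimately have "convex hull ({z. transpose (elem_mat i j (1/2) (1 - 1/2)) *v z \<in> pullback simplex0 (t / 2)}
       \<union> {z. transpose (elem_mat j i (1/2) (1 - 1/2)) *v z \<in> pullback simplex0 (t / 2)}) \<subseteq> pullback simplex0 (t / 2)"
    by (rule hull_minimal[rotated])
  thus "pullback simplex0 t \<subseteq> pullback simplex0 (t / 2)"
    by (subst pullback_simplex0_cut[OF ij _ _ assms, of "1/2"]) simp_all
qed

text \<open>For \<open>r < 1\<close>, monotonicity squeezes the set between those for
  \<open>t\<close> and for \<open>t\<close> divided by a power of two, which agree. For
  \<open>r > 1\<close> the roles of \<open>t\<close> and \<open>t * r\<close> are exchanged.\<close>

lemma pullback_simplex0_scale: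
  assumes "t \<noteq> 0" "r > 0"
  shows "pullback simplex0 (t * r) = pullback simplex0 t"
proof -
  have lt: "pullback simplex0 (t * r) = pullback simplex0 t" if t: "t \<noteq> 0" and r: "0 < r" "r < 1" for t r
  proof
    show "pullback simplex0 (t * r) \<subseteq> pullback simplex0 t" using pullback_simplex0_mono t r by blast
    have pow: "pullback simplex0 (t * (1/2)^m) = pullback simplex0 t" for m
    proof (induction m)
      case (Suc m)
      thus ?case using pullback_simplex0_half[of "t * (1/2)^m"] t by simp
    qed simp
    obtain m where m: "(1/2)^m < r" using real_arch_pow_inv[OF r(1), of "1/2"] by auto
    have "pullback simplex0 (t * r * ((1/2)^m / r)) \<subseteq> pullback simplex0 (t * r)"
      by (rule pullback_simplex0_mono) (use t r m in auto)
    thus "pullback simplex0 t \<subseteq> pullback simplex0 (t * r)" using pow[of m] r by simp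
  qed
  consider "r < 1" | "r = 1" | "r > 1" by linarith
  thus ?thesis
  proof cases
    case 3
    thus ?thesis using lt[of "t * r" "1 / r"] assms by simp
  qed (use lt assms in auto)
qed

text \<open>Swapping two coordinates has determinant \<open>- 1\<close>, preserves the simplex and
  fixes \<open>1\<close>. The reverse inclusion is the same statement for
  \<open>- t\<close>.\<close>

lemma pullback_simplex0_neg:
  assumes t: "t \<noteq> 0"
  shows "pullback simplex0 (- t) \<subseteq> pullback simplex0 t"
proof
  fix z assume z: "z \<in> pullback simplex0 (- t)"
  obtain s where s: "z = s *\<^sub>R 1" using pullback_simplex0_line[OF _ z] t by auto
  obtain C y where C: "z = transpose C *v y" "det C = - t" "y \<in> Z ((*v) C ` simplex0)"
    using z unfolding pullback_def by blast
  obtain i j :: 'n where ij: "i \<noteq> j" using exists_third_index[OF card_ge_3] by metis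
  define p where "p = Transposition.transpose i j"
  have p: "p permutes UNIV" "p (p x) = x" for x by (simp_all add: p_def permutes_swap_id)
  define Q :: "real^'n^'n" where "Q = (\<chi> r s. (mat 1 :: real^'n^'n) $ r $ p s)"
  have dQ: "det Q = - 1" unfolding Q_def det_permute_columns[OF p(1)] by (simp add: p_def sign_swap_id ij)
  have Qx: "Q *v x = (\<chi> r. x $ p r)" for x
  proof -
    have "(Q *v x) $ r = x $ p r" for r
    proof -
      have "(Q *v x) $ r = (\<Sum>s\<in>UNIV. if s = p r then x $ s else 0)"
        unfolding Q_def matrix_vector_mult_def vec_lambda_beta mat_def by (rule sum.cong) (use p(2) in auto)
      thus ?thesis by simp
    qed
    thus ?thesis by (simp add: vec_eq_iff)
  qed
  have one: "1 \<bullet> (Q *v x) = 1 \<bullet> x" for x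
    unfolding Qx inner_one_vec vec_lambda_beta using sum.permute[OF p(1), of "\<lambda>r. x $ r"] by (simp add: comp_def)
  have "(*v) Q ` simplex0 = simplex0"
  proof
    show sub: "(*v) Q ` simplex0 \<subseteq> simplex0"
      unfolding simplex0_def by (auto simp: one) (auto simp: Qx)
    have "Q *v (Q *v x) = x" for x by (simp add: Qx p(2) vec_eq_iff)
    hence "x \<in> (*v) Q ` simplex0" if "x \<in> simplex0" for x
      using that sub by (intro image_eqI[of _ _ "Q *v x"]) auto
    thus "simplex0 \<subseteq> (*v) Q ` simplex0" by blast
  qed
  moreover have "(*v) (C ** Q) ` simplex0 = (*v) C ` (*v) Q ` simplex0"
    by (simp add: image_image matrix_vector_mul_assoc)
  ultimately have "(*v) (C ** Q) ` simplex0 = (*v) C ` simplex0" by simp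
  moreover have "det (C ** Q) = t" by (simp add: det_mul C dQ)
  moreover have "transpose Q *v 1 = 1"
    by (rule vector_eq_rdot[THEN iffD1]) (simp add: inner_transpose_vector one)
  hence "transpose (C ** Q) *v y = z"
    by (simp add: transpose_mult_vector C(1)[symmetric] s matrix_vector_mult_scaleR)
  ultimately show "z \<in> pullback simplex0 t" using C(3) unfolding pullback_def
    by (intro CollectI exI[of _ "C ** Q"] exI[of _ y]) simp
qed

lemma pullback_simplex0_eq:
  assumes "t \<noteq> 0" shows "pullback simplex0 t = Z simplex0"
proof -
  have 1: "pullback simplex0 1 = Z simplex0"
    using pullback_eq_image[OF simplex0_Po, of "mat 1"] by (simp add: transpose_mat)
  have pos: "pullback simplex0 t = Z simplex0" if "t > 0" for t using pullback_simplex0_scale[of 1 t] that 1 by simp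
  show ?thesis
  proof (cases "t > 0")
    case False
    hence "pullback simplex0 (- t) = Z simplex0" using pos assms by simp
    thus ?thesis using pullback_simplex0_neg[of t] pullback_simplex0_neg[of "- t"] assms by auto
  qed (use pos in auto)
qed

text \<open>\<open>v\<close> is the functional equal to \<open>1\<close> on the facet opposite to
  the origin, and \<open>transpose B\<close> carries its multiples to those of \<open>1\<close>,
  where the determinant no longer matters.\<close>

lemma Z_simplex:
  assumes "det B \<noteq> 0" "transpose B *v v = 1"
  shows "Z ((*v) B ` simplex0) = {s *\<^sub>R v |s. s *\<^sub>R 1 \<in> Z simplex0}"
proof -
  have "y \<in> Z ((*v) B ` simplex0) \<longleftrightarrow> (\<exists>s. y = s *\<^sub>R v \<and> s *\<^sub>R 1 \<in> Z simplex0)" for y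
  proof -
    have mem: "y \<in> Z ((*v) B ` simplex0) \<longleftrightarrow> transpose B *v y \<in> Z simplex0"
      using Z_image_pullback[OF simplex0_Po assms(1)] pullback_simplex0_eq[OF assms(1)] by simp
    have sv: "transpose B *v (s *\<^sub>R v) = s *\<^sub>R 1" for s by (simp add: matrix_vector_mult_scaleR assms(2))
    show ?thesis
    proof
      assume y: "y \<in> Z ((*v) B ` simplex0)"
      hence "transpose B *v y \<in> pullback simplex0 (det B)"
        using mem pullback_simplex0_eq[OF assms(1)] by blast
      then obtain s where s: "transpose B *v y = s *\<^sub>R 1"
        using pullback_simplex0_line[OF assms(1)] by blast
      have "det (transpose B) \<noteq> 0" using assms(1) by (simp add: det_transpose)
      hence "y = s *\<^sub>R v" by (rule matrix_vector_cancel) (simp only: s sv)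
      thus "\<exists>s. y = s *\<^sub>R v \<and> s *\<^sub>R 1 \<in> Z simplex0" using y mem s by auto
    qed (use mem sv in auto)
  qed
  thus ?thesis by blast
qed

text \<open>Monotonicity squeezes \<open>Z P\<close> between the values on an outer and an inner
  simplex with the same base hyperplane, which agree by \<open>Z_simplex\<close>.\<close>

lemma Z_pyramid:
  assumes P: "P \<in> Po" "finite W" "P = {x. v \<bullet> x \<le> 1 \<and> (\<forall>w\<in>W. w \<bullet> x \<le> 0)}" and ne: "interior P \<noteq> {}"
  shows "Z P = {s *\<^sub>R v |s. s *\<^sub>R 1 \<in> Z simplex0}"
proof -
  have c2: "CARD('n) \<ge> 2" using card_ge_3 by simp
  have "P \<noteq> {0}" using ne by auto
  then obtain x1 where x1: "x1 \<in> P" "x1 \<noteq> 0" using P(1) by (auto simp: Po_def)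
  hence v0: "v \<noteq> 0" using pyramid_ray[OF P(1,3) x1] by auto
  obtain k :: 'n where True by blast
  obtain a where a: "a \<notin> span {v}" using exists_not_in_span_singleton[OF c2] by blast
  \<comment> \<open>Supplies the partner vector that \<open>linear_automorphism_pairs\<close> asks
    for; the matrix is wanted for \<open>A *v v = 1\<close>.\<close>
  have "axis k (1::real) \<notin> span {1}"
  proof
    assume "axis k (1::real) \<in> span {1}"
    then obtain c where c: "axis k (1::real) = c *\<^sub>R 1" by (auto simp: span_singleton)
    hence "c \<noteq> 0" by (auto simp: axis_eq_0_iff)
    hence "1 = inverse c *\<^sub>R axis k (1::real)" using c by simp
    thus False using axis_one_independent[OF c2, of k] by (auto simp: span_singleton)
  qed
  then obtain A where A: "det A \<noteq> 0" "A *v v = 1"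
    using linear_automorphism_pairs[OF v0 a one_neq_zero] by blast
  define B where "B = transpose A"
  have B: "det B \<noteq> 0" "transpose B *v v = 1" using A by (auto simp: B_def det_transpose transpose_transpose)
  obtain Q W' where Q: "Q \<in> Po" "finite W'" "Q = {x. 1 \<bullet> x \<le> 1 \<and> (\<forall>w\<in>W'. w \<bullet> x \<le> 0)}" "P = (*v) B ` Q"
    using pyramid_pullback[OF P B] by blast
  have mono: "Z (R \<inter> {x. \<forall>w\<in>V. w \<bullet> x \<le> 0}) \<subseteq> Z R" if "R \<in> Po" "finite V" for R V
    using Z_mono_cut[OF that Z_cut_hull] by blast
  have S: "Z ((*v) (B ** stretch e p) ` simplex0) = {s *\<^sub>R v |s. s *\<^sub>R 1 \<in> Z simplex0}" 
    if "e > 0" "1 \<bullet> p = 1" for e p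
    by (rule Z_simplex) (use B that det_stretch[of e p] in \<open>auto simp: det_mul transpose_mult_vector transpose_stretch_one\<close>)
  have vs: "v \<bullet> ((B ** stretch e p) *v z) = 1 \<bullet> z" if "e > 0" "1 \<bullet> p = 1" for e p z
  proof -
    have "v \<bullet> ((B ** stretch e p) *v z) = 1 \<bullet> (stretch e p *v z)"
      unfolding matrix_vector_mul_assoc[symmetric] inner_transpose_vector[symmetric] B(2) by simp
    also have "\<dots> = 1 \<bullet> z" by (rule inner_one_stretch) (use that in auto)
    finally show ?thesis .
  qed
  have im: "(*v) B ` (*v) G ` S = (*v) (B ** G) ` S" for G :: "real^'n^'n" and S
    by (simp add: image_image matrix_vector_mul_assoc)
  show ?thesis
  proof
    define p :: "real^'n" where "p = (\<chi> i. 1 / real CARD('n))"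
    have p: "1 \<bullet> p = 1" by (simp add: inner_one_vec p_def)
    obtain e where e: "e > 0" "Q \<subseteq> (*v) (stretch e p) ` simplex0"
      by (rule pyramid_outer_simplex[OF Q(1,3) p, of "real CARD('n)"]) (auto simp: p_def)
    let ?S = "(*v) (B ** stretch e p) ` simplex0"
    have "P \<subseteq> ?S" using e(2) Q(4) im by blast
    moreover have "v \<bullet> x \<le> 1" if "x \<in> ?S" for x
      using that vs[OF e(1) p] by (auto simp: simplex0_def)
    ultimately have PW: "?S \<inter> {x. \<forall>w\<in>W. w \<bullet> x \<le> 0} = P" using P(3) by blast
    have "Z (?S \<inter> {x. \<forall>w\<in>W. w \<bullet> x \<le> 0}) \<subseteq> Z ?S"
      by (rule mono[OF Po_linear_image[OF simplex0_Po] P(2)])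
    hence "Z P \<subseteq> Z ?S" unfolding PW .
    thus "Z P \<subseteq> {s *\<^sub>R v |s. s *\<^sub>R 1 \<in> Z simplex0}" using S[OF e(1) p] by simp
  next
    have "interior Q \<noteq> {}"
    proof -
      have "interior P = (*v) B ` interior Q" unfolding Q(4)
        by (rule interior_injective_linear_image) (use inj_matrix_vector[OF B(1)] in auto)
      thus ?thesis using ne by auto
    qed
    then obtain e p where e: "e > 0" "1 \<bullet> p = 1" "(*v) (stretch e p) ` simplex0 \<subseteq> Q"
      using pyramid_inner_simplex[OF Q(1,3)] by metis
    let ?G = "B ** stretch e p"
    let ?S = "(*v) ?G ` simplex0"
    have dG: "det ?G \<noteq> 0" using B det_stretch[of e p] e by (simp add: det_mul)
    obtain D where D: "?G ** D = mat 1" "D ** ?G = mat 1" using det_nz_inverse[OF dG] by metis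
    have GD: "?G *v (D *v x) = x" "D *v (?G *v x) = x" for x by (simp_all only: matrix_vector_mul_assoc D matrix_vector_mul_lid)
    \<comment> \<open>The negated rows of the inverse \<open>D\<close>: these constraints make the
      coordinates of \<open>D *v x\<close> nonnegative and so cut the inner simplex out of
      \<open>P\<close>.\<close>
    define V where "V = range (\<lambda>i. - (transpose D *v axis i 1))"
    have V: "(\<forall>w\<in>V. w \<bullet> x \<le> 0) \<longleftrightarrow> (\<forall>i. (D *v x) $ i \<ge> 0)" for x
      by (auto simp: V_def inner_transpose_vector inner_axis')
    have PV: "P \<inter> {x. \<forall>w\<in>V. w \<bullet> x \<le> 0} = ?S"
    proof (intro equalityI subsetI)
      fix x assume x: "x \<in> ?S"
      moreover have "?S \<subseteq> P" using e(3) Q(4) im by blast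
      ultimately show "x \<in> P \<inter> {x. \<forall>w\<in>V. w \<bullet> x \<le> 0}" unfolding Int_iff mem_Collect_eq V
        using GD(2) by (auto simp: simplex0_def)
    next
      fix x assume x: "x \<in> P \<inter> {x. \<forall>w\<in>V. w \<bullet> x \<le> 0}"
      have "1 \<bullet> (D *v x) = v \<bullet> x" using vs[OF e(1,2), of "D *v x"] GD(1) by simp
      hence "D *v x \<in> simplex0" using x V P(3) by (auto simp: simplex0_def)
      thus "x \<in> ?S" using GD(1) by (metis image_eqI)
    qed
    have "Z (P \<inter> {x. \<forall>w\<in>V. w \<bullet> x \<le> 0}) \<subseteq> Z P"
      by (rule mono[OF P(1)]) (simp add: V_def)
    hence "Z ?S \<subseteq> Z P" unfolding PV .
    thus "{s *\<^sub>R v |s. s *\<^sub>R 1 \<in> Z simplex0} \<subseteq> Z P" using S[OF e(1,2)] by simp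
  qed
qed

end

text \<open>Pyramids without interior lie in a hyperplane through the origin and have value
  \<open>{0}\<close>, the others are settled by \<open>Z_pyramid\<close>, and
  \<open>Z_cut_hull\<close> carries the equality through cuts.\<close>

theorem linf_contravariant_valuation_unique:
  fixes Z Y :: "(real^'n) set \<Rightarrow> (real^'n) set"
  assumes "linf_contravariant_valuation Z" "linf_contravariant_valuation Y"
    and eq: "Z simplex0 = Y simplex0" and "P \<in> Po"
  shows "Z P = Y P"
  using \<open>P \<in> Po\<close>
proof (induction rule: Po_induct)
  case (pyramid P v W)
  show ?case
  proof (cases "interior P = {}")
    case True
    have "convex P" "0 \<in> P" using pyramid(1) by (auto simp: Po_def polytope_imp_convex)
    then obtain a b where ab: "a \<noteq> 0" "P \<subseteq> {x. a \<bullet> x = b}"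
      using empty_interior_subset_hyperplane[OF _ True] by metis
    hence "b = 0" using \<open>0 \<in> P\<close> by auto
    hence "P \<subseteq> {x. a \<bullet> x = 0}" using ab by simp
    thus ?thesis
      using linf_contravariant_valuation.Z_hyperplane[OF assms(1) pyramid(1) ab(1)]
        linf_contravariant_valuation.Z_hyperplane[OF assms(2) pyramid(1) ab(1)] by simp
  next
    case False
    show ?thesis
      using linf_contravariant_valuation.Z_pyramid[OF assms(1) pyramid False]
        linf_contravariant_valuation.Z_pyramid[OF assms(2) pyramid False] eq by simp
  qed
next
  case (cut P b)
  show ?case
    unfolding linf_contravariant_valuation.Z_cut_hull[OF assms(1) cut(1), of b]
      linf_contravariant_valuation.Z_cut_hull[OF assms(2) cut(1), of b] cut(2,3) ..
qed

section \<open>Facets not containing the origin\<close>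

text \<open>The vectors \<open>u / h\<^sub>P(u)\<close>, where \<open>u\<close> is the normal of a facet not containing the origin.\<close>

definition facet_duals :: "(real^'n) set \<Rightarrow> (real^'n) set" where
  "facet_duals P = {v. (\<forall>x\<in>P. v \<bullet> x \<le> 1) \<and> aff_dim (P \<inter> {x. v \<bullet> x = 1}) = int CARD('n) - 1}"

lemma aff_dim_hyperplane_cart:
  "a \<noteq> (0::real^'n) \<Longrightarrow> aff_dim {x. a \<bullet> x = r} = int CARD('n) - 1"
proof -
  assume "a \<noteq> (0::real^'n)"
  have "CARD('n) \<ge> 1" by (simp add: Suc_leI)
  thus ?thesis using aff_dim_hyperplane[OF \<open>a \<noteq> 0\<close>, of r] by simp
qed

lemma facet_duals_affine_hull:
  fixes v :: "real^'n"
  assumes "v \<in> facet_duals P"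
  shows "v \<noteq> 0" "affine hull (P \<inter> {x. v \<bullet> x = 1}) = {x. v \<bullet> x = 1}"
proof -
  let ?F = "P \<inter> {x. v \<bullet> x = 1}"
  have d: "aff_dim ?F = int CARD('n) - 1" using assms by (simp add: facet_duals_def)
  have "CARD('n) \<ge> 1" by (simp add: Suc_leI)
  hence ne: "?F \<noteq> {}" using d by (auto simp: aff_dim_empty_eq)
  thus v: "v \<noteq> 0" by auto
  show "affine hull ?F = {x. v \<bullet> x = 1}"
  proof (rule affine_dim_equal)
    show "affine hull ?F \<subseteq> {x. v \<bullet> x = 1}" by (rule hull_minimal) (auto simp: affine_hyperplane)
    show "aff_dim (affine hull ?F) = aff_dim {x. v \<bullet> x = 1}"
      using d aff_dim_hyperplane_cart[OF v] by (simp add: aff_dim_affine_hull)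
  qed (use ne in \<open>auto simp: affine_hyperplane affine_affine_hull\<close>)
qed

text \<open>A relative interior point of the facet has a neighbourhood in the hyperplane that lies
  in \<open>P\<close>, and conversely such a neighbourhood has full dimension in the hyperplane.
  This local form suits unions and intersections.\<close>

lemma facet_duals_iff:
  fixes P :: "(real^'n) set"
  assumes "convex P"
  shows "v \<in> facet_duals P \<longleftrightarrow> (\<forall>x\<in>P. v \<bullet> x \<le> 1) \<and>
    (\<exists>x r. r > 0 \<and> v \<bullet> x = 1 \<and> ball x r \<inter> {y. v \<bullet> y = 1} \<subseteq> P)"
proof
  let ?F = "P \<inter> {x. v \<bullet> x = 1}"
  assume v: "v \<in> facet_duals P"
  have "convex ?F" using assms by (simp add: convex_Int convex_hyperplane)
  moreover have "?F \<noteq> {}"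
  proof
    assume "?F = {}"
    hence "{x. v \<bullet> x = 1} = {}" using facet_duals_affine_hull(2)[OF v] by simp
    moreover have "v \<bullet> ((1 / (v \<bullet> v)) *\<^sub>R v) = 1" using facet_duals_affine_hull(1)[OF v] by simp
    ultimately show False by blast
  qed
  ultimately obtain x where "x \<in> rel_interior ?F" using rel_interior_eq_empty by blast
  then obtain r where "x \<in> ?F" "r > 0" "ball x r \<inter> affine hull ?F \<subseteq> ?F" unfolding mem_rel_interior_ball by blast
  hence "r > 0 \<and> v \<bullet> x = 1 \<and> ball x r \<inter> {y. v \<bullet> y = 1} \<subseteq> P"
    unfolding facet_duals_affine_hull(2)[OF v] by blast
  thus "(\<forall>x\<in>P. v \<bullet> x \<le> 1) \<and> (\<exists>x r. r > 0 \<and> v \<bullet> x = 1 \<and> ball x r \<inter> {y. v \<bullet> y = 1} \<subseteq> P)"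
    using v unfolding facet_duals_def by blast
next
  let ?F = "P \<inter> {x. v \<bullet> x = 1}"
  assume "(\<forall>x\<in>P. v \<bullet> x \<le> 1) \<and> (\<exists>x r. r > 0 \<and> v \<bullet> x = 1 \<and> ball x r \<inter> {y. v \<bullet> y = 1} \<subseteq> P)"
  then obtain x r where le: "\<forall>x\<in>P. v \<bullet> x \<le> 1" and x: "r > 0" "v \<bullet> x = 1" "ball x r \<inter> {y. v \<bullet> y = 1} \<subseteq> P" by blast
  have v: "v \<noteq> 0" using x by auto
  have "affine hull ({y. v \<bullet> y = 1} \<inter> ball x r) = affine hull {y. v \<bullet> y = 1}"
    by (rule affine_hull_affine_Int_open) (use x in \<open>auto simp: affine_hyperplane\<close>)
  hence "aff_dim ({y. v \<bullet> y = 1} \<inter> ball x r) = int CARD('n) - 1"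
    using aff_dim_hyperplane_cart[OF v, of 1] by (metis aff_dim_affine_hull)
  moreover have "aff_dim ({y. v \<bullet> y = 1} \<inter> ball x r) \<le> aff_dim ?F" by (rule aff_dim_subset) (use x in auto)
  moreover have "aff_dim ?F \<le> aff_dim {y. v \<bullet> y = 1}" by (rule aff_dim_subset) auto
  ultimately show "v \<in> facet_duals P" using le aff_dim_hyperplane_cart[OF v, of 1] by (simp add: facet_duals_def)
qed

section \<open>Comparison with outer normals and support numbers\<close>

lemma supp_eqI:
  assumes "\<And>x. x \<in> P \<Longrightarrow> u \<bullet> x \<le> h" "x0 \<in> P" "u \<bullet> x0 = h"
  shows "supp P u = h"
  unfolding supp_def by (rule cSup_eq_maximum) (use assms in auto)

lemma inner_le_supp:
  assumes "P \<in> Po" "x \<in> P" shows "u \<bullet> x \<le> supp P u"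
  unfolding supp_def
proof (rule cSup_upper)
  have "bounded P" using assms by (simp add: Po_def polytope_imp_bounded)
  hence "bounded ((\<lambda>y. u \<bullet> y) ` P)" by (rule bounded_linear_image) (rule bounded_linear_inner_right)
  thus "bdd_above ((\<lambda>y. u \<bullet> y) ` P)" by (rule bounded_imp_bdd_above)
qed (use assms in auto)

text \<open>Division by \<open>h = supp P u\<close> turns the bound \<open>h\<close> on
  \<open>u\<close> into the bound \<open>1\<close> on \<open>v\<close>. The origin in
  \<open>P\<close> forces \<open>h\<close> to be nonnegative, and \<open>h = 0\<close> would put
  \<open>u\<close> into \<open>normals_o P\<close>. Conversely, the unit vector along
  \<open>v\<close> has support number \<open>1 / norm v\<close>.\<close>

lemma polar_normals_eq_facet_duals:
  fixes P :: "(real^'n) set"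
  assumes P: "P \<in> Po"
  shows "(\<lambda>u. (1 / supp P u) *\<^sub>R u) ` (normals P - normals_o P) = facet_duals P"
proof (intro equalityI subsetI)
  have cP: "convex P" "0 \<in> P" using P by (auto simp: Po_def polytope_imp_convex)
  fix v assume "v \<in> (\<lambda>u. (1 / supp P u) *\<^sub>R u) ` (normals P - normals_o P)"
  then obtain u F where u: "v = (1 / supp P u) *\<^sub>R u" "u \<notin> normals_o P" "is_facet F P" "outer_normal P F u"
    by (auto simp: normals_def)
  define h where "h = supp P u"
  have le: "u \<bullet> x \<le> h" if "x \<in> P" for x unfolding h_def by (rule inner_le_supp[OF P that])
  have "u \<noteq> 0" using u(4) by (auto simp: outer_normal_def)
  have "h \<ge> 0" using le[OF cP(2)] by simp
  have F: "F \<subseteq> P \<inter> {x. u \<bullet> x = h}" "aff_dim F = int CARD('n) - 1"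
    using u(3,4) by (auto simp: is_facet_def outer_normal_def h_def dest: face_of_imp_subset)
  \<comment> \<open>A priori \<open>F\<close> is only contained in the slice; comparing dimensions
    gives the slice the dimension of a facet.\<close>
  have d: "aff_dim (P \<inter> {x. u \<bullet> x = h}) = int CARD('n) - 1"
  proof -
    have "aff_dim (P \<inter> {x. u \<bullet> x = h}) \<le> aff_dim {x. u \<bullet> x = h}" by (rule aff_dim_subset) auto
    thus ?thesis using aff_dim_subset[OF F(1)] F(2) aff_dim_hyperplane_cart[OF \<open>u \<noteq> 0\<close>, of h] by linarith
  qed
  have "h \<noteq> 0"
  proof
    assume h0: "h = 0"
    have "is_facet (P \<inter> {x. u \<bullet> x = h}) P" unfolding is_facet_def
      using d face_of_Int_supporting_hyperplane_le[OF cP(1) le] by blast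
    moreover have "0 \<in> P \<inter> {x. u \<bullet> x = h}" using cP h0 by simp
    moreover have "outer_normal P (P \<inter> {x. u \<bullet> x = h}) u"
      using u(4) by (auto simp: outer_normal_def h_def)
    ultimately have "u \<in> normals_o P" unfolding normals_o_def by blast
    thus False using u(2) by blast
  qed
  hence h: "h > 0" using \<open>h \<ge> 0\<close> by simp
  have v: "v \<bullet> x = (u \<bullet> x) / h" for x by (simp add: u(1) h_def)
  have "{x. v \<bullet> x = 1} = {x. u \<bullet> x = h}" using h by (auto simp: v)
  thus "v \<in> facet_duals P" unfolding facet_duals_def using d le h by (auto simp: v)
next
  fix v assume v: "v \<in> facet_duals P"
  have cP: "convex P" "0 \<in> P" using P by (auto simp: Po_def polytope_imp_convex)
  let ?F = "P \<inter> {x. v \<bullet> x = 1}"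
  have le: "v \<bullet> x \<le> 1" if "x \<in> P" for x using v that by (auto simp: facet_duals_def)
  obtain x0 where x0: "x0 \<in> P" "v \<bullet> x0 = 1" using v unfolding facet_duals_iff[OF cP(1)] by force
  have v0: "v \<noteq> 0" using x0 by auto
  define u where "u = (1 / norm v) *\<^sub>R v"
  have s: "supp P u = 1 / norm v"
    by (rule supp_eqI[OF _ x0(1)]) (use le x0 v0 in \<open>auto simp: u_def divide_right_mono\<close>)
  have "is_facet ?F P"
    using v face_of_Int_supporting_hyperplane_le[OF cP(1) le] by (simp add: is_facet_def facet_duals_def)
  moreover have "outer_normal P ?F u" using v0 by (auto simp: outer_normal_def s) (simp_all add: u_def)
  ultimately have "u \<in> normals P" by (auto simp: normals_def)
  moreover have "u \<notin> normals_o P"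
  proof
    assume "u \<in> normals_o P"
    then obtain F where F: "0 \<in> F" "\<forall>x\<in>F. u \<bullet> x = supp P u" by (auto simp: normals_o_def outer_normal_def)
    hence "supp P u = 0" by (metis inner_zero_right)
    thus False using s v0 by simp
  qed
  moreover have "v = (1 / supp P u) *\<^sub>R u" using v0 by (simp add: s) (simp add: u_def)
  ultimately show "v \<in> (\<lambda>u. (1 / supp P u) *\<^sub>R u) ` (normals P - normals_o P)" by blast
qed

lemma Pi_plus_facet_duals: "P \<in> Po \<Longrightarrow> Pi_plus P = convex hull insert 0 (facet_duals P)"
  by (simp only: Pi_plus_def polar_normals_eq_facet_duals)

text \<open>The foot point \<open>y\<close> of the origin on the hyperplane shows that
  \<open>w - v\<close> is parallel to it; translating \<open>y\<close> by \<open>w - v\<close> shows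
  that this vector is orthogonal to itself.\<close>

lemma hyperplane_one_inj:
  fixes v w :: "'a::real_inner"
  assumes "{x. v \<bullet> x = 1} = {x. w \<bullet> x = 1}" "v \<noteq> 0"
  shows "v = w"
proof -
  have eq: "v \<bullet> x = 1 \<longleftrightarrow> w \<bullet> x = 1" for x using assms(1) by blast
  define y where "y = (1 / (v \<bullet> v)) *\<^sub>R v"
  have vy: "v \<bullet> y = 1" using assms(2) by (simp add: y_def)
  hence wy: "w \<bullet> y = 1" using eq by blast
  have "w \<bullet> v = v \<bullet> v" using wy assms(2) by (simp add: y_def)
  hence vd: "v \<bullet> (w - v) = 0" by (simp add: inner_diff_right inner_commute[of v w])
  have "v \<bullet> (y + (w - v)) = 1" using vy vd by (simp only: inner_add_right)
  hence "w \<bullet> (y + (w - v)) = 1" using eq by blast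
  hence "w \<bullet> (w - v) = 0" using wy by (simp only: inner_add_right)
  hence "(w - v) \<bullet> (w - v) = 0" using vd by (simp only: inner_diff_left)
  thus ?thesis by simp
qed

text \<open>A polytope has finitely many faces, and a facet determines its \<open>v\<close> through
  its affine hull.\<close>

lemma finite_facet_duals:
  fixes P :: "(real^'n) set"
  assumes "P \<in> Po" shows "finite (facet_duals P)"
proof (rule inj_on_finite)
  let ?f = "\<lambda>v. P \<inter> {x. v \<bullet> x = 1}"
  show "inj_on ?f (facet_duals P)"
  proof (rule inj_onI)
    fix v w assume vw: "v \<in> facet_duals P" "w \<in> facet_duals P" "?f v = ?f w"
    have "{x. v \<bullet> x = 1} = affine hull ?f v" by (rule facet_duals_affine_hull(2)[OF vw(1), symmetric])
    also have "\<dots> = affine hull ?f w" by (simp only: vw(3))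
    also have "\<dots> = {x. w \<bullet> x = 1}" by (rule facet_duals_affine_hull(2)[OF vw(2)])
    finally have "{x. v \<bullet> x = 1} = {x. w \<bullet> x = 1}" .
    thus "v = w" by (rule hyperplane_one_inj) (rule facet_duals_affine_hull(1)[OF vw(1)])
  qed
  show "?f ` facet_duals P \<subseteq> {F. F face_of P}"
  proof clarify
    fix v assume v: "v \<in> facet_duals P"
    show "?f v face_of P"
      by (rule face_of_Int_supporting_hyperplane_le)
        (use assms v in \<open>auto simp: Po_def facet_duals_def polytope_imp_convex\<close>)
  qed
  show "finite {F. F face_of P}" using assms by (simp add: Po_def finite_polytope_faces)
qed

section \<open>Facet duals under linear maps, unions and intersections\<close>

lemma facet_duals_linear_image:
  fixes A :: "real^'n^'n"
  assumes "det A \<noteq> 0"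
  shows "facet_duals ((*v) A ` P) = {v. transpose A *v v \<in> facet_duals P}"
proof -
  have "(*v) A ` P \<inter> {x. v \<bullet> x = 1} = (*v) A ` (P \<inter> {x. (transpose A *v v) \<bullet> x = 1})" for v
    by (auto simp: inner_transpose_vector)
  hence "aff_dim ((*v) A ` P \<inter> {x. v \<bullet> x = 1}) = aff_dim (P \<inter> {x. (transpose A *v v) \<bullet> x = 1})" for v
    by (simp only: aff_dim_injective_linear_image[OF matrix_vector_mul_linear inj_matrix_vector[OF assms]])
  thus ?thesis by (auto simp: facet_duals_def inner_transpose_vector)
qed

text \<open>Otherwise some \<open>p\<close> in \<open>K\<close> and \<open>q\<close> in
  \<open>L\<close> lie beyond the hyperplane. Joining them to the common neighbourhood of
  \<open>x\<close> in the hyperplane produces a point of \<open>K \<inter> L\<close> beyond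
  it.\<close>

lemma facet_duals_Int_subset:
  fixes K L :: "(real^'n) set"
  assumes "convex K" "convex L"
  shows "facet_duals (K \<inter> L) \<subseteq> facet_duals K \<union> facet_duals L"
proof
  fix v assume "v \<in> facet_duals (K \<inter> L)"
  then obtain x r where le: "\<forall>x\<in>K \<inter> L. v \<bullet> x \<le> 1"
    and x: "r > 0" "v \<bullet> x = 1" "ball x r \<inter> {y. v \<bullet> y = 1} \<subseteq> K \<inter> L"
    unfolding facet_duals_iff[OF convex_Int[OF assms]] by blast
  have xKL: "x \<in> K" "x \<in> L" using x by auto
  have "(\<forall>y\<in>K. v \<bullet> y \<le> 1) \<or> (\<forall>y\<in>L. v \<bullet> y \<le> 1)"
  proof (rule ccontr)
    assume "\<not> ?thesis"
    then obtain p q where pq: "p \<in> K" "q \<in> L" "v \<bullet> p > 1" "v \<bullet> q > 1" by force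
    \<comment> \<open>Excesses of \<open>p\<close> and \<open>q\<close> over the hyperplane. Used
      crosswise as factors, they give \<open>z1\<close> and \<open>z2\<close> the same excess, so
      \<open>z2 - z1\<close> is parallel to the hyperplane.\<close>
    define \<alpha> where "\<alpha> = v \<bullet> p - 1"
    define \<beta> where "\<beta> = v \<bullet> q - 1"
    have ab: "\<alpha> > 0" "\<beta> > 0" using pq by (auto simp: \<alpha>_def \<beta>_def)
    define C where "C = \<alpha> + \<beta> + \<beta> * norm (p - x) + \<alpha> * norm (q - x) + 1"
    have nn: "\<beta> * norm (p - x) \<ge> 0" "\<alpha> * norm (q - x) \<ge> 0" using ab by auto
    have C: "C > 0" using ab nn unfolding C_def by linarith
    define s where "s = min (r / C) (1 / C)"
    have s: "s > 0" "s * C \<le> r" "s * C \<le> 1" using C x(1) by (auto simp: s_def min_def field_simps)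
    define z1 where "z1 = (s * \<beta>) *\<^sub>R (p - x)"
    define z2 where "z2 = (s * \<alpha>) *\<^sub>R (q - x)"
    have vz: "v \<bullet> z1 = s * \<beta> * \<alpha>" "v \<bullet> z2 = s * \<beta> * \<alpha>"
      using x(2) by (auto simp: z1_def z2_def \<alpha>_def \<beta>_def inner_diff_right)
    have "s * \<beta> \<le> s * C" "s * \<alpha> \<le> s * C" using s(1) ab nn by (auto simp: C_def)
    hence s1: "s * \<beta> \<le> 1" "s * \<alpha> \<le> 1" using s(3) by linarith+
    have "x + z1 = (1 - s * \<beta>) *\<^sub>R x + (s * \<beta>) *\<^sub>R p" by (simp add: z1_def algebra_simps)
    hence K1: "x + z1 \<in> K" using convexD_alt[OF assms(1) xKL(1) pq(1), of "s * \<beta>"] s s1 ab by simp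
    have "x + z2 = (1 - s * \<alpha>) *\<^sub>R x + (s * \<alpha>) *\<^sub>R q" by (simp add: z2_def algebra_simps)
    hence L1: "x + z2 \<in> L" using convexD_alt[OF assms(2) xKL(2) pq(2), of "s * \<alpha>"] s s1 ab by simp
    have "norm (z2 - z1) \<le> s * (\<beta> * norm (p - x) + \<alpha> * norm (q - x))"
    proof -
      have "norm (z2 - z1) \<le> norm z2 + norm z1" by (rule norm_triangle_ineq4)
      also have "norm z2 = s * \<alpha> * norm (q - x)" using s ab by (simp add: z2_def)
      also have "norm z1 = s * \<beta> * norm (p - x)" using s ab by (simp add: z1_def)
      also have "s * \<alpha> * norm (q - x) + s * \<beta> * norm (p - x) = s * (\<beta> * norm (p - x) + \<alpha> * norm (q - x))"
        by (simp add: algebra_simps)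
      finally show ?thesis .
    qed
    also have "\<dots> < s * C" using s(1) ab by (simp add: C_def)
    finally have nz: "norm (z2 - z1) < r" using s(2) by simp
    \<comment> \<open>The midpoint of \<open>x + z1\<close> and \<open>?y1\<close> coincides with
      that of \<open>x + z2\<close> and \<open>?y2\<close>, so \<open>?m\<close> lies in both
      sets.\<close>
    let ?y1 = "x + (1/2) *\<^sub>R (z2 - z1)" and ?y2 = "x + (1/2) *\<^sub>R (z1 - z2)"
    have "?y1 \<in> ball x r" "?y2 \<in> ball x r" using nz x(1) by (auto simp: dist_norm norm_minus_commute)
    moreover have "v \<bullet> ?y1 = 1" "v \<bullet> ?y2 = 1" using vz x(2) by (auto simp: inner_add_right inner_diff_right)
    ultimately have y: "?y1 \<in> K" "?y2 \<in> L" using x(3) by auto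
    let ?m = "x + (1/4) *\<^sub>R (z1 + z2)"
    have "?m = (1 - 1/2) *\<^sub>R (x + z1) + (1/2) *\<^sub>R ?y1" by (simp add: vec_eq_iff field_simps)
    hence "?m \<in> K" using convexD_alt[OF assms(1) K1 y(1), of "1/2"] by simp
    moreover have "?m = (1 - 1/2) *\<^sub>R (x + z2) + (1/2) *\<^sub>R ?y2" by (simp add: vec_eq_iff field_simps)
    hence "?m \<in> L" using convexD_alt[OF assms(2) L1 y(2), of "1/2"] by simp
    ultimately have "v \<bullet> ?m \<le> 1" using le by blast
    moreover have "v \<bullet> ?m = 1 + s * \<beta> * \<alpha> / 2" using vz x(2) by (simp add: inner_add_right)
    moreover have "s * \<beta> * \<alpha> > 0" using s ab by simp
    ultimately show False by linarith
  qed
  thus "v \<in> facet_duals K \<union> facet_duals L"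
    unfolding Un_iff facet_duals_iff[OF assms(1)] facet_duals_iff[OF assms(2)] using x by blast
qed

text \<open>If the neighbourhood of \<open>x\<close> leaves \<open>K\<close>, closedness of
  \<open>K\<close> yields a smaller one that avoids \<open>K\<close> and hence lies in
  \<open>L\<close>.\<close>

lemma facet_duals_Un_subset:
  fixes K L :: "(real^'n) set"
  assumes "convex K" "convex L" "closed K" "convex (K \<union> L)"
  shows "facet_duals (K \<union> L) \<subseteq> facet_duals K \<union> facet_duals L"
proof
  fix v assume "v \<in> facet_duals (K \<union> L)"
  then obtain x r where le: "\<forall>x\<in>K \<union> L. v \<bullet> x \<le> 1"
    and x: "r > 0" "v \<bullet> x = 1" "ball x r \<inter> {y. v \<bullet> y = 1} \<subseteq> K \<union> L"
    unfolding facet_duals_iff[OF assms(4)] by blast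
  show "v \<in> facet_duals K \<union> facet_duals L"
  proof (cases "ball x r \<inter> {y. v \<bullet> y = 1} \<subseteq> K")
    case True
    thus ?thesis using le x facet_duals_iff[OF assms(1), of v] by blast
  next
    case False
    then obtain y where y: "y \<in> ball x r" "v \<bullet> y = 1" "y \<notin> K" by blast
    have "open (ball x r - K)" using assms(3) by (simp add: open_Diff)
    then obtain e where e: "e > 0" "ball y e \<subseteq> ball x r - K" using y unfolding open_contains_ball by blast
    hence "ball y e \<inter> {y. v \<bullet> y = 1} \<subseteq> L" using x(3) by blast
    thus ?thesis using le e(1) y(2) facet_duals_iff[OF assms(2), of v] by blast
  qed
qed

text \<open>Either the neighbourhood lies in \<open>K \<inter> L\<close>, or it contains a point
  \<open>y\<close> with no point of \<open>L\<close> nearby. Then a point of the union beyond the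
  hyperplane would, by convexity, give points of \<open>K\<close> beyond it near
  \<open>y\<close>.\<close>

lemma facet_duals_subset_Un_Int:
  fixes K L :: "(real^'n) set"
  assumes "convex K" "convex L" "closed L" "convex (K \<union> L)"
  shows "facet_duals K \<subseteq> facet_duals (K \<union> L) \<union> facet_duals (K \<inter> L)"
proof
  fix v assume "v \<in> facet_duals K"
  then obtain x r where le: "\<forall>x\<in>K. v \<bullet> x \<le> 1"
    and x: "r > 0" "v \<bullet> x = 1" "ball x r \<inter> {y. v \<bullet> y = 1} \<subseteq> K"
    unfolding facet_duals_iff[OF assms(1)] by blast
  show "v \<in> facet_duals (K \<union> L) \<union> facet_duals (K \<inter> L)"
  proof (cases "ball x r \<inter> {y. v \<bullet> y = 1} \<subseteq> L")
    case True
    hence "ball x r \<inter> {y. v \<bullet> y = 1} \<subseteq> K \<inter> L" using x(3) by blast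
    thus ?thesis using le x facet_duals_iff[OF convex_Int[OF assms(1,2)], of v] by blast
  next
    case False
    then obtain y where y: "y \<in> ball x r" "v \<bullet> y = 1" "y \<notin> L" by blast
    have "open (ball x r - L)" using assms(3) by (simp add: open_Diff)
    then obtain e where e: "e > 0" "ball y e \<subseteq> ball x r - L" using y unfolding open_contains_ball by blast
    have sub: "ball y e \<inter> {y. v \<bullet> y = 1} \<subseteq> K \<union> L" using x(3) e(2) by blast
    have "v \<bullet> q \<le> 1" if q: "q \<in> K \<union> L" for q
    proof (rule ccontr)
      assume "\<not> v \<bullet> q \<le> 1"
      hence vq: "v \<bullet> q > 1" by simp
      \<comment> \<open>Keeps \<open>?m\<close> within distance \<open>e\<close> of
        \<open>y\<close>; adding \<open>1\<close> keeps the denominator positive.\<close>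
      define s where "s = min 1 (e / (2 * (norm (q - y) + 1)))"
      have n1: "norm (q - y) + 1 > 0" by (simp add: add_nonneg_pos)
      have s: "0 < s" "s \<le> 1" using e n1 by (auto simp: s_def)
      have yK: "y \<in> K" using y x(3) by blast
      let ?m = "(1 - s) *\<^sub>R y + s *\<^sub>R q"
      have "?m \<in> K \<union> L" using convexD_alt[OF assms(4) _ q, of y s] s yK by simp
      moreover have "?m \<in> ball y e"
      proof -
        have "s * norm (q - y) \<le> s * (norm (q - y) + 1)" using s by simp
        also have "\<dots> \<le> e / (2 * (norm (q - y) + 1)) * (norm (q - y) + 1)"
          by (rule mult_right_mono) (auto simp: s_def)
        also have "\<dots> = e / 2" using n1 by (simp add: field_simps)
        finally have "s * norm (q - y) < e" using e by simp
        moreover have "?m - y = s *\<^sub>R (q - y)" by (simp add: algebra_simps)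
        ultimately show ?thesis using s by (simp add: dist_norm norm_minus_commute[of y])
      qed
      ultimately have "?m \<in> K" using e(2) by blast
      moreover have "v \<bullet> ?m = 1 + s * (v \<bullet> q - 1)" using y(2) by (simp add: inner_add_right algebra_simps)
      moreover have "s * (v \<bullet> q - 1) > 0" using s(1) vq by simp
      ultimately show False using le by force
    qed
    thus ?thesis using sub e(1) y(2) facet_duals_iff[OF assms(4), of v] by blast
  qed
qed

lemma facet_duals_valuation:
  fixes K L :: "(real^'n) set"
  assumes "K \<in> Po" "L \<in> Po" "K \<union> L \<in> Po"
  shows "facet_duals (K \<union> L) \<union> facet_duals (K \<inter> L) = facet_duals K \<union> facet_duals L"
proof -
  have c: "convex K" "convex L" "convex (K \<union> L)" "closed K" "closed L" "convex (L \<union> K)"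
    using assms by (auto simp: Po_def polytope_imp_convex polytope_imp_closed Un_commute)
  show ?thesis
    using facet_duals_Int_subset[OF c(1,2)] facet_duals_Un_subset[OF c(1,2,4,3)]
      facet_duals_subset_Un_Int[OF c(1,2,5,3)] facet_duals_subset_Un_Int[OF c(2,1,4,6)]
    unfolding Un_commute[of L K] Int_commute[of L K] by blast
qed

text \<open>The vertices give \<open>v $ i \<le> 1\<close>. On the facet the terms
  \<open>(1 - v $ i) * y $ i\<close> are nonnegative with sum at most zero, so
  \<open>v $ k < 1\<close> would confine the facet to \<open>y $ k = 0\<close>.\<close>

lemma facet_duals_simplex0: "facet_duals (simplex0 :: (real^'n) set) = {1}"
proof -
  have cT: "convex (simplex0 :: (real^'n) set)"
    using simplex0_Po[where 'n='n] by (simp add: Po_def polytope_imp_convex)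
  have ax: "axis i 1 \<in> (simplex0 :: (real^'n) set)" for i
    by (simp add: simplex0_def inner_axis) (simp add: axis_def)
  have "v = 1" if v: "v \<in> facet_duals simplex0" for v :: "real^'n"
  proof -
    obtain x r where le: "\<forall>x\<in>simplex0. v \<bullet> x \<le> 1" and x: "r > 0" "v \<bullet> x = 1"
      and sub: "ball x r \<inter> {y. v \<bullet> y = 1} \<subseteq> simplex0"
      using v unfolding facet_duals_iff[OF cT] by blast
    have v1: "v $ i \<le> 1" for i using le ax[of i] by (metis inner_axis inner_real_def mult.right_neutral)
    have zero: "y $ k = 0" if y: "y \<in> simplex0" "v \<bullet> y = 1" and k: "v $ k < 1" for y k
    proof -
      have nn: "(1 - v $ i) * y $ i \<ge> 0" for i using v1 y by (simp add: simplex0_def)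
      have "(\<Sum>i\<in>UNIV. (1 - v $ i) * y $ i) = 1 \<bullet> y - v \<bullet> y"
        by (simp add: inner_vec_def left_diff_distrib sum_subtractf)
      also have "\<dots> \<le> 0" using y by (simp add: simplex0_def)
      finally have "(\<Sum>i\<in>UNIV. (1 - v $ i) * y $ i) = 0" using nn by (simp add: sum_nonneg order_antisym)
      hence "(1 - v $ k) * y $ k = 0" using nn by (simp add: sum_nonneg_eq_0_iff)
      thus ?thesis using k by simp
    qed
    have "\<not> v $ k < 1" for k
    proof
      assume k: "v $ k < 1"
      have xT: "x \<in> simplex0" using sub x by auto
      have xk: "x $ k = 0" by (rule zero[OF xT x(2) k])
      obtain m where m: "v $ m * x $ m \<noteq> 0"
      proof -
        have "(\<Sum>i\<in>UNIV. v $ i * x $ i) \<noteq> 0" using x(2) by (simp add: inner_vec_def)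
        thus ?thesis using that by (meson sum.neutral)
      qed
      hence mk: "m \<noteq> k" using xk by auto
      \<comment> \<open>A direction within the hyperplane of the facet whose \<open>k\<close>-th
        coordinate \<open>v $ m\<close> is nonzero.\<close>
      define d :: "real^'n" where "d = axis k (v $ m) - axis m (v $ k)"
      have vd: "v \<bullet> d = 0" by (simp add: d_def inner_diff_right inner_axis)
      have dk: "d $ k = v $ m" using mk by (simp add: d_def axis_def)
      have "d \<noteq> 0" using dk m by auto
      define y where "y = x + (r / (2 * norm d)) *\<^sub>R d"
      have "y \<in> ball x r" using x(1) \<open>d \<noteq> 0\<close> by (simp add: y_def dist_norm)
      moreover have vy: "v \<bullet> y = 1" using x(2) vd by (simp add: y_def inner_add_right)
      ultimately have "y \<in> simplex0" using sub by blast
      hence "y $ k = 0" using zero vy k by blast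
      thus False using xk dk m x(1) \<open>d \<noteq> 0\<close> by (simp add: y_def)
    qed
    hence "v $ k = 1" for k using v1[of k] by (simp add: not_less order_antisym)
    thus ?thesis by (simp add: vec_eq_iff)
  qed
  moreover have "1 \<in> facet_duals (simplex0 :: (real^'n) set)"
  proof -
    \<comment> \<open>Common coordinate of the barycentre of the facet, and a radius within which
      coordinates stay nonnegative.\<close>
    define c where "c = 1 / real CARD('n)"
    have c: "c > 0" by (simp add: c_def)
    define x :: "real^'n" where "x = (\<chi> i. c)"
    have "y \<in> simplex0" if y: "y \<in> ball x c" "1 \<bullet> y = 1" for y
    proof -
      have "y $ i \<ge> 0" for i
      proof -
        have "\<bar>(x - y) $ i\<bar> \<le> norm (x - y)" by (rule component_le_norm_cart)
        also have "\<dots> < c" using y(1) by (simp add: dist_norm)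
        finally show ?thesis by (simp add: x_def)
      qed
      thus ?thesis using y(2) by (simp add: simplex0_def)
    qed
    moreover have "1 \<bullet> x = 1" by (simp add: inner_one_vec x_def c_def)
    ultimately show ?thesis unfolding facet_duals_iff[OF cT] using c
      by (intro conjI exI[of _ x] exI[of _ c]) (auto simp: simplex0_def)
  qed
  ultimately show ?thesis by blast
qed

section \<open>The classification\<close>

text \<open>Generators of the body in the classification. They are compatible with unions of
  \<open>V\<close> and with linear maps, so properties of \<open>facet_duals\<close> pass to the
  hull.\<close>

definition two_sided :: "real \<Rightarrow> real \<Rightarrow> (real^'n) set \<Rightarrow> (real^'n) set" where
  "two_sided c d V = (*\<^sub>R) c ` insert 0 V \<union> (*\<^sub>R) (- d) ` insert 0 V"

definition linf_projection :: "real \<Rightarrow> real \<Rightarrow> (real^'n) set \<Rightarrow> (real^'n) set" where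
  "linf_projection c d P = dil c (Pi_plus P) +\<^sub>\<infinity> dil d (Pi_minus P)"

lemma linf_projection_eq:
  assumes "P \<in> Po"
  shows "linf_projection c d P = convex hull two_sided c d (facet_duals P)"
proof -
  let ?V = "insert 0 (facet_duals P)"
  have 1: "dil c (Pi_plus P) = convex hull ((*\<^sub>R) c ` ?V)"
    unfolding Pi_plus_facet_duals[OF assms] dil_def by (rule convex_hull_scaling[symmetric])
  have "dil d (Pi_minus P) = (*\<^sub>R) (- d) ` (convex hull ?V)"
    unfolding Pi_minus_def Pi_plus_facet_duals[OF assms] dil_def by (simp add: image_image)
  also have "\<dots> = convex hull ((*\<^sub>R) (- d) ` ?V)" by (rule convex_hull_scaling[symmetric])
  finally show ?thesis
    unfolding linf_projection_def linf_plus_def 1 two_sided_def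
    by (simp only: hull_Un_left[symmetric] hull_Un_right[symmetric])
qed

lemma linf_projection_locale:
  assumes "CARD('n) \<ge> 3"
  shows "linf_contravariant_valuation (linf_projection c d :: (real^'n) set \<Rightarrow> (real^'n) set)"
proof
  show "CARD('n) \<ge> 3" by fact
  show "linf_projection c d P \<in> Ko" if "P \<in> Po" for P :: "(real^'n) set"
  proof -
    have "finite (two_sided c d (facet_duals P))" using finite_facet_duals[OF that] by (simp add: two_sided_def)
    moreover have "0 \<in> two_sided c d (facet_duals P)" by (auto simp: two_sided_def)
    ultimately show ?thesis unfolding linf_projection_eq[OF that] Ko_def
      by (simp add: finite_imp_compact_convex_hull hull_inc)
  qed
  show "linf_valuation (linf_projection c d :: (real^'n) set \<Rightarrow> (real^'n) set)"
    unfolding linf_valuation_def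
  proof (intro allI impI, elim conjE)
    fix K L :: "(real^'n) set"
    assume Po: "K \<in> Po" "L \<in> Po" "K \<union> L \<in> Po" "K \<inter> L \<in> Po"
    have hull: "convex hull two_sided c d V +\<^sub>\<infinity> convex hull two_sided c d V' = convex hull two_sided c d (V \<union> V')"
      for V V' :: "(real^'n) set"
    proof -
      have "two_sided c d (V \<union> V') = two_sided c d V \<union> two_sided c d V'" by (auto simp: two_sided_def)
      thus ?thesis by (simp only: linf_plus_def hull_Un_left[symmetric] hull_Un_right[symmetric])
    qed
    show "linf_projection c d (K \<union> L) +\<^sub>\<infinity> linf_projection c d (K \<inter> L) = linf_projection c d K +\<^sub>\<infinity> linf_projection c d L"
      unfolding linf_projection_eq[OF Po(1)] linf_projection_eq[OF Po(2)] linf_projection_eq[OF Po(3)]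
        linf_projection_eq[OF Po(4)] hull facet_duals_valuation[OF Po(1-3)] ..
  qed
  show "SL_contravariant (linf_projection c d :: (real^'n) set \<Rightarrow> (real^'n) set)"
    unfolding SL_contravariant_def
  proof (intro ballI allI impI)
    fix P :: "(real^'n) set" and A :: "real^'n^'n"
    assume P: "P \<in> Po" and A: "det A = 1"
    define N where "N = matrix_inv (transpose A)"
    have "invertible (transpose A)" using A by (simp add: invertible_det_nz)
    hence N: "transpose A ** N = mat 1 \<and> N ** transpose A = mat 1"
      unfolding N_def matrix_inv_def invertible_def by (rule someI_ex)
    have NA: "N *v (transpose A *v x) = x" "transpose A *v (N *v x) = x" for x
      by (simp_all only: matrix_vector_mul_assoc N matrix_vector_mul_lid)
    have "facet_duals ((*v) A ` P) = {v. transpose A *v v \<in> facet_duals P}"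
      by (rule facet_duals_linear_image) (simp add: A)
    also have "\<dots> = (*v) N ` facet_duals P"
    proof (intro equalityI subsetI)
      fix v assume "v \<in> {v. transpose A *v v \<in> facet_duals P}"
      thus "v \<in> (*v) N ` facet_duals P" using NA(1)[of v] by (intro image_eqI[of _ _ "transpose A *v v"]) auto
    qed (auto simp: NA)
    finally have V: "facet_duals ((*v) A ` P) = (*v) N ` facet_duals P" .
    have "two_sided c d ((*v) N ` facet_duals P) = (*v) N ` two_sided c d (facet_duals P)"
      by (simp only: two_sided_def image_Un image_image image_insert matrix_vector_mult_scaleR
          scaleR_zero_right matrix_vector_mult_0_right)
    thus "linf_projection c d ((*v) A ` P) = (*v) N ` linf_projection c d P"
      unfolding linf_projection_eq[OF P] linf_projection_eq[OF Po_linear_image[OF P]] V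
      by (simp only: convex_hull_linear_image[OF matrix_vector_mul_linear])
  qed
qed

text \<open>The only facet dual is \<open>1\<close>, so the body is spanned by the multiples
  \<open>0\<close>, \<open>c\<close> and \<open>- d\<close> of it.\<close>

lemma linf_projection_simplex0:
  assumes "c \<ge> 0" "d \<ge> 0"
  shows "linf_projection c d simplex0 = (\<lambda>s. s *\<^sub>R (1 :: real^'n)) ` {- d..c}"
proof -
  have hull: "convex hull {0, c, - d} = {- d..c}"
  proof
    show "convex hull {0, c, - d} \<subseteq> {- d..c}" by (rule hull_minimal) (use assms in auto)
    have "{- d..c} = convex hull {- d, c}" 
      unfolding segment_convex_hull[symmetric] using assms by (simp add: closed_segment_eq_real_ivl)
    also have "\<dots> \<subseteq> convex hull {0, c, - d}" by (rule hull_mono) auto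
    finally show "{- d..c} \<subseteq> convex hull {0, c, - d}" .
  qed
  have lin: "linear (\<lambda>s::real. s *\<^sub>R (1 :: real^'n))" by (rule linearI) (simp_all add: algebra_simps)
  have "two_sided c d {1 :: real^'n} = (\<lambda>s. s *\<^sub>R 1) ` {0, c, - d}" by (auto simp: two_sided_def)
  thus ?thesis
    unfolding linf_projection_eq[OF simplex0_Po] facet_duals_simplex0
    by (simp only: convex_hull_linear_image[OF lin, symmetric] hull)
qed

text \<open>On the line through \<open>1\<close> any coordinate is a parameter, and its values form
  a compact connected set containing \<open>0\<close>.\<close>

lemma (in linf_contravariant_valuation) Z_simplex0_segment:
  obtains c d where "c \<ge> 0" "d \<ge> 0" "Z simplex0 = (\<lambda>s. s *\<^sub>R 1) ` {- d..c}"
proof -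
  obtain k :: 'n where True by blast
  have line: "z = z $ k *\<^sub>R 1" if z: "z \<in> Z simplex0" for z
  proof -
    have "z \<in> pullback simplex0 1" using z by (simp add: pullback_simplex0_eq)
    then obtain s where "z = s *\<^sub>R 1" using pullback_simplex0_line[OF one_neq_zero] by blast
    thus ?thesis by simp
  qed
  let ?I = "(\<lambda>z. z $ k) ` Z simplex0"
  have cont: "continuous_on (Z simplex0) (\<lambda>z. z $ k)" by (intro continuous_intros)
  have "compact ?I" by (rule compact_continuous_image[OF cont Z_compact[OF simplex0_Po]])
  moreover have "connected ?I"
    by (rule connected_continuous_image[OF cont convex_connected[OF Z_convex[OF simplex0_Po]]])
  ultimately have "\<exists>a b. ?I = {a..b}" using connected_compact_interval_1[of ?I] by simp
  then obtain a b where ab: "?I = {a..b}" by (elim exE)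
  have "0 \<in> ?I" by (rule image_eqI[OF _ Z_zero[OF simplex0_Po]]) simp
  hence "a \<le> 0" "b \<ge> 0" unfolding ab by auto
  have "Z simplex0 = (\<lambda>z. z) ` Z simplex0" by simp
  also have "\<dots> = (\<lambda>z. z $ k *\<^sub>R 1) ` Z simplex0" by (rule image_cong[OF refl line])
  also have "\<dots> = (\<lambda>s. s *\<^sub>R 1) ` ?I" unfolding image_image ..
  finally have "Z simplex0 = (\<lambda>s. s *\<^sub>R 1) ` {- (- a)..b}" unfolding ab by simp
  thus ?thesis using that[of b "- a"] \<open>a \<le> 0\<close> \<open>b \<ge> 0\<close> by (simp only: neg_0_le_iff_le)
qed

theorem theorem1p3:
  fixes Z :: "(real^'n) set \<Rightarrow> (real^'n) set"
  assumes "CARD('n) \<ge> 3"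
    and "\<forall>P \<in> Po. Z P \<in> Ko"
  shows "(linf_valuation Z \<and> SL_contravariant Z) \<longleftrightarrow>
         (\<exists>c1 \<ge> 0. \<exists>c2 \<ge> 0. \<forall>P \<in> Po. Z P = dil c1 (Pi_plus P) +\<^sub>\<infinity> dil c2 (Pi_minus P))"
proof
  assume "linf_valuation Z \<and> SL_contravariant Z"
  then interpret Z: linf_contravariant_valuation Z by unfold_locales (use assms in auto)
  obtain c d where cd: "c \<ge> 0" "d \<ge> 0" "Z simplex0 = (\<lambda>s. s *\<^sub>R 1) ` {- d..c}"
    using Z.Z_simplex0_segment .
  \<comment> \<open>The constants were read off on the simplex, so both maps agree there and
    uniqueness applies.\<close>
  have "Z P = linf_projection c d P" if "P \<in> Po" for P
    by (rule linf_contravariant_valuation_unique[OF Z.linf_contravariant_valuation_axioms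
          linf_projection_locale[OF assms(1)] _ that])
       (simp add: cd linf_projection_simplex0)
  thus "\<exists>c1 \<ge> 0. \<exists>c2 \<ge> 0. \<forall>P \<in> Po. Z P = dil c1 (Pi_plus P) +\<^sub>\<infinity> dil c2 (Pi_minus P)"
    using cd(1,2) unfolding linf_projection_def by blast
next
  assume "\<exists>c1 \<ge> 0. \<exists>c2 \<ge> 0. \<forall>P \<in> Po. Z P = dil c1 (Pi_plus P) +\<^sub>\<infinity> dil c2 (Pi_minus P)"
  \<comment> \<open>The maps are known to agree only on \<open>Po\<close>, and both properties
    concern only members of \<open>Po\<close>.\<close>
  then obtain c d where eq: "\<And>P. P \<in> Po \<Longrightarrow> Z P = linf_projection c d P"
    unfolding linf_projection_def by blast
  interpret W: linf_contravariant_valuation "linf_projection c d :: (real^'n) set \<Rightarrow> (real^'n) set"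
    by (rule linf_projection_locale[OF assms(1)])
  show "linf_valuation Z \<and> SL_contravariant Z"
  proof
    show "linf_valuation Z" unfolding linf_valuation_def
    proof (intro allI impI, elim conjE)
      fix K L :: "(real^'n) set"
      assume Po: "K \<in> Po" "L \<in> Po" "K \<union> L \<in> Po" "K \<inter> L \<in> Po"
      show "Z (K \<union> L) +\<^sub>\<infinity> Z (K \<inter> L) = Z K +\<^sub>\<infinity> Z L"
        unfolding Po[THEN eq] using W.Z_valuation Po unfolding linf_valuation_def by blast
    qed
    show "SL_contravariant Z" unfolding SL_contravariant_def
    proof (intro ballI allI impI)
      fix K :: "(real^'n) set" and A :: "real^'n^'n"
      assume "K \<in> Po" "det A = 1"
      thus "Z ((*v) A ` K) = (*v) (matrix_inv (transpose A)) ` Z K"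
        unfolding eq[OF \<open>K \<in> Po\<close>] eq[OF Po_linear_image[OF \<open>K \<in> Po\<close>]]
        using W.Z_contravariant unfolding SL_contravariant_def by blast
    qed
  qed
qed

end
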